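(* Let $H$ be a Hopf algebra over a field $k$ which is left noetherian. (1) If $H$ satisfies (FF), then $H$ is of $S$-finite type; consequently $\dim_k H$ is countable. (2) If $H$ satisfies (FF) and $H$ is locally affine, then $H$ is affine. (3) If $H$ is pointed, then $H$ is affine.
   Context: $k$ is algebraically closed of characteristic zero. $S$ denotes the antipode. $H$ is affine if it is finitely generated as a $k$-algebra. $H$ is locally affine if every finite subset of $H$ is contained in an affine Hopf subalgebra of $H$. $H$ is of $S$-finite type if there is a finite-dimensional subspace $V\subseteq H$ such that $H$ is generated as an algebra by $\bigcup_{i\ge0}S^i(V)$. $H$ satisfies (FF) if for every Hopf subalgebra $K\subseteq H$, $H$ is faithfully flat both as a right $K$-module and as a left $K$-module. Pointed means all simple subcoalgebras are one-dimensional. *)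

theory Defs
  imports Main "HOL-Library.Countable_Set" "HOL-Computational_Algebra.Polynomial"
begin

definition alg_closed :: "'k::field itself \<Rightarrow> bool" where
  "alg_closed _ \<longleftrightarrow> (\<forall>p::'k poly. degree p > 0 \<longrightarrow> (\<exists>x. poly p x = 0))"

text \<open>An element of H (x) H is represented by a list of pairs (a_i, b_i), standing for
  the sum of the a_i (x) b_i. Two representatives denote the same tensor iff they agree
  under all f (x) g for linear functionals f, g (pure tensors of functionals separate
  points of a tensor product of vector spaces). Similarly for H (x) H (x) H.\<close>

definition lin_functional :: "('k::field \<Rightarrow> 'h::ab_group_add \<Rightarrow> 'h) \<Rightarrow> ('h \<Rightarrow> 'k) \<Rightarrow> bool" where
  "lin_functional sc f \<longleftrightarrow> Vector_Spaces.linear sc ((*) :: 'k \<Rightarrow> 'k \<Rightarrow> 'k) f"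

definition tens_eq :: "('k::field \<Rightarrow> 'h::ab_group_add \<Rightarrow> 'h) \<Rightarrow> ('h \<times> 'h) list \<Rightarrow> ('h \<times> 'h) list \<Rightarrow> bool" where
  "tens_eq sc t u \<longleftrightarrow> (\<forall>f g. lin_functional sc f \<and> lin_functional sc g \<longrightarrow>
      sum_list (map (\<lambda>(a,b). f a * g b) t) = sum_list (map (\<lambda>(a,b). f a * g b) u))"

definition tens3_eq :: "('k::field \<Rightarrow> 'h::ab_group_add \<Rightarrow> 'h) \<Rightarrow> ('h \<times> 'h \<times> 'h) list \<Rightarrow> ('h \<times> 'h \<times> 'h) list \<Rightarrow> bool" where
  "tens3_eq sc t u \<longleftrightarrow> (\<forall>f g h. lin_functional sc f \<and> lin_functional sc g \<and> lin_functional sc h \<longrightarrow>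
      sum_list (map (\<lambda>(a,b,c). f a * g b * h c) t) = sum_list (map (\<lambda>(a,b,c). f a * g b * h c) u))"

definition in_tens2 :: "('k::field \<Rightarrow> 'h::ab_group_add \<Rightarrow> 'h) \<Rightarrow> 'h set \<Rightarrow> ('h \<times> 'h) list \<Rightarrow> bool" where
  "in_tens2 sc C t \<longleftrightarrow> (\<exists>u. set u \<subseteq> C \<times> C \<and> tens_eq sc t u)"

definition hopf_algebra ::
  "('k::field \<Rightarrow> 'h::ring_1 \<Rightarrow> 'h) \<Rightarrow> ('h \<Rightarrow> ('h \<times> 'h) list) \<Rightarrow> ('h \<Rightarrow> 'k) \<Rightarrow> ('h \<Rightarrow> 'h) \<Rightarrow> bool" where
  "hopf_algebra sc \<Delta> \<epsilon> S \<longleftrightarrow>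
     vector_space sc \<and>
     (\<forall>c x y. sc c (x * y) = sc c x * y \<and> sc c (x * y) = x * sc c y) \<and>
     (\<forall>x y. tens_eq sc (\<Delta> (x + y)) (\<Delta> x @ \<Delta> y)) \<and>
     (\<forall>c x. tens_eq sc (\<Delta> (sc c x)) (map (\<lambda>(a,b). (sc c a, b)) (\<Delta> x))) \<and>
     (\<forall>x. tens3_eq sc
        (concat (map (\<lambda>(a,b). map (\<lambda>(c,d). (c,d,b)) (\<Delta> a)) (\<Delta> x)))
        (concat (map (\<lambda>(a,b). map (\<lambda>(c,d). (a,c,d)) (\<Delta> b)) (\<Delta> x)))) \<and>
     lin_functional sc \<epsilon> \<and>
     (\<forall>x. sum_list (map (\<lambda>(a,b). sc (\<epsilon> a) b) (\<Delta> x)) = x \<and>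
          sum_list (map (\<lambda>(a,b). sc (\<epsilon> b) a) (\<Delta> x)) = x) \<and>
     (\<forall>x y. tens_eq sc (\<Delta> (x * y))
        (concat (map (\<lambda>(a,b). map (\<lambda>(c,d). (a * c, b * d)) (\<Delta> y)) (\<Delta> x)))) \<and>
     tens_eq sc (\<Delta> 1) [(1, 1)] \<and>
     (\<forall>x y. \<epsilon> (x * y) = \<epsilon> x * \<epsilon> y) \<and> \<epsilon> 1 = 1 \<and>
     Vector_Spaces.linear sc sc S \<and>
     (\<forall>x. sum_list (map (\<lambda>(a,b). S a * b) (\<Delta> x)) = sc (\<epsilon> x) 1 \<and>
          sum_list (map (\<lambda>(a,b). a * S b) (\<Delta> x)) = sc (\<epsilon> x) 1)"

definition subalgebra :: "('k::field \<Rightarrow> 'h::ring_1 \<Rightarrow> 'h) \<Rightarrow> 'h set \<Rightarrow> bool" where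
  "subalgebra sc A \<longleftrightarrow> module.subspace sc A \<and> 1 \<in> A \<and> (\<forall>x\<in>A. \<forall>y\<in>A. x * y \<in> A)"

definition alg_gen :: "('k::field \<Rightarrow> 'h::ring_1 \<Rightarrow> 'h) \<Rightarrow> 'h set \<Rightarrow> 'h set" where
  "alg_gen sc X = \<Inter>{A. subalgebra sc A \<and> X \<subseteq> A}"

definition hopf_subalgebra ::
  "('k::field \<Rightarrow> 'h::ring_1 \<Rightarrow> 'h) \<Rightarrow> ('h \<Rightarrow> ('h \<times> 'h) list) \<Rightarrow> ('h \<Rightarrow> 'h) \<Rightarrow> 'h set \<Rightarrow> bool" where
  "hopf_subalgebra sc \<Delta> S K \<longleftrightarrow> subalgebra sc K \<and> (\<forall>x\<in>K. in_tens2 sc K (\<Delta> x)) \<and> S ` K \<subseteq> K"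

definition affine :: "('k::field \<Rightarrow> 'h::ring_1 \<Rightarrow> 'h) \<Rightarrow> bool" where
  "affine sc \<longleftrightarrow> (\<exists>F. finite F \<and> alg_gen sc F = UNIV)"

definition locally_affine ::
  "('k::field \<Rightarrow> 'h::ring_1 \<Rightarrow> 'h) \<Rightarrow> ('h \<Rightarrow> ('h \<times> 'h) list) \<Rightarrow> ('h \<Rightarrow> 'h) \<Rightarrow> bool" where
  "locally_affine sc \<Delta> S \<longleftrightarrow> (\<forall>F. finite F \<longrightarrow>
     (\<exists>K. hopf_subalgebra sc \<Delta> S K \<and> F \<subseteq> K \<and> (\<exists>G. finite G \<and> G \<subseteq> K \<and> alg_gen sc G = K)))"

definition S_finite_type :: "('k::field \<Rightarrow> 'h::ring_1 \<Rightarrow> 'h) \<Rightarrow> ('h \<Rightarrow> 'h) \<Rightarrow> bool" where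
  "S_finite_type sc S \<longleftrightarrow> (\<exists>V. module.subspace sc V \<and> (\<exists>B. finite B \<and> module.span sc B = V) \<and>
       alg_gen sc (\<Union>i. (S ^^ i) ` V) = UNIV)"

definition countable_dim :: "('k::field \<Rightarrow> 'h::ab_group_add \<Rightarrow> 'h) \<Rightarrow> bool" where
  "countable_dim sc \<longleftrightarrow> (\<exists>B. \<not> module.dependent sc B \<and> module.span sc B = UNIV \<and> countable B)"

definition left_ideal :: "'h::ring_1 set \<Rightarrow> bool" where
  "left_ideal I \<longleftrightarrow> 0 \<in> I \<and> (\<forall>x\<in>I. \<forall>y\<in>I. x + y \<in> I) \<and> (\<forall>r x. x \<in> I \<longrightarrow> r * x \<in> I)"

definition left_noetherian :: "'h::ring_1 itself \<Rightarrow> bool" where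
  "left_noetherian _ \<longleftrightarrow> (\<forall>I :: nat \<Rightarrow> 'h set. (\<forall>n. left_ideal (I n)) \<and> (\<forall>n. I n \<subseteq> I (Suc n))
      \<longrightarrow> (\<exists>N. \<forall>n\<ge>N. I n = I N))"

text \<open>Flatness via the equational criterion; faithful flatness of a flat module M
  over K via: M I \<noteq> M for every proper one-sided ideal I of K (the side matching the
  tensor product).\<close>

definition right_flat_over :: "'h::ring_1 set \<Rightarrow> bool" where
  "right_flat_over K \<longleftrightarrow> (\<forall>n (m::nat \<Rightarrow> 'h) r. (\<forall>i<n. r i \<in> K) \<and> (\<Sum>i<n. m i * r i) = 0 \<longrightarrow>
     (\<exists>p (y::nat \<Rightarrow> 'h) (a::nat \<Rightarrow> nat \<Rightarrow> 'h). (\<forall>j<p. \<forall>i<n. a j i \<in> K) \<and>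
        (\<forall>i<n. m i = (\<Sum>j<p. y j * a j i)) \<and> (\<forall>j<p. (\<Sum>i<n. a j i * r i) = 0)))"

definition left_flat_over :: "'h::ring_1 set \<Rightarrow> bool" where
  "left_flat_over K \<longleftrightarrow> (\<forall>n (m::nat \<Rightarrow> 'h) r. (\<forall>i<n. r i \<in> K) \<and> (\<Sum>i<n. r i * m i) = 0 \<longrightarrow>
     (\<exists>p (y::nat \<Rightarrow> 'h) (a::nat \<Rightarrow> nat \<Rightarrow> 'h). (\<forall>i<n. \<forall>j<p. a i j \<in> K) \<and>
        (\<forall>i<n. m i = (\<Sum>j<p. a i j * y j)) \<and> (\<forall>j<p. (\<Sum>i<n. r i * a i j) = 0)))"

definition left_ideal_of :: "'h::ring_1 set \<Rightarrow> 'h set \<Rightarrow> bool" where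
  "left_ideal_of K I \<longleftrightarrow> I \<subseteq> K \<and> 0 \<in> I \<and> (\<forall>x\<in>I. \<forall>y\<in>I. x + y \<in> I) \<and> (\<forall>r\<in>K. \<forall>x\<in>I. r * x \<in> I)"

definition right_ideal_of :: "'h::ring_1 set \<Rightarrow> 'h set \<Rightarrow> bool" where
  "right_ideal_of K I \<longleftrightarrow> I \<subseteq> K \<and> 0 \<in> I \<and> (\<forall>x\<in>I. \<forall>y\<in>I. x + y \<in> I) \<and> (\<forall>r\<in>K. \<forall>x\<in>I. x * r \<in> I)"

definition right_faithfully_flat_over :: "'h::ring_1 set \<Rightarrow> bool" where
  "right_faithfully_flat_over K \<longleftrightarrow> right_flat_over K \<and>
     (\<forall>I. left_ideal_of K I \<and> I \<noteq> K \<longrightarrow>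
        {\<Sum>i<n. m i * r i | (n::nat) m r. \<forall>i<n. r i \<in> I} \<noteq> (UNIV :: 'h set))"

definition left_faithfully_flat_over :: "'h::ring_1 set \<Rightarrow> bool" where
  "left_faithfully_flat_over K \<longleftrightarrow> left_flat_over K \<and>
     (\<forall>I. right_ideal_of K I \<and> I \<noteq> K \<longrightarrow>
        {\<Sum>i<n. r i * m i | (n::nat) m r. \<forall>i<n. r i \<in> I} \<noteq> (UNIV :: 'h set))"

definition FF :: "('k::field \<Rightarrow> 'h::ring_1 \<Rightarrow> 'h) \<Rightarrow> ('h \<Rightarrow> ('h \<times> 'h) list) \<Rightarrow> ('h \<Rightarrow> 'h) \<Rightarrow> bool" where
  "FF sc \<Delta> S \<longleftrightarrow> (\<forall>K. hopf_subalgebra sc \<Delta> S K \<longrightarrow>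
      right_faithfully_flat_over K \<and> left_faithfully_flat_over K)"

definition subcoalgebra :: "('k::field \<Rightarrow> 'h::ring_1 \<Rightarrow> 'h) \<Rightarrow> ('h \<Rightarrow> ('h \<times> 'h) list) \<Rightarrow> 'h set \<Rightarrow> bool" where
  "subcoalgebra sc \<Delta> C \<longleftrightarrow> module.subspace sc C \<and> (\<forall>x\<in>C. in_tens2 sc C (\<Delta> x))"

definition simple_subcoalgebra :: "('k::field \<Rightarrow> 'h::ring_1 \<Rightarrow> 'h) \<Rightarrow> ('h \<Rightarrow> ('h \<times> 'h) list) \<Rightarrow> 'h set \<Rightarrow> bool" where
  "simple_subcoalgebra sc \<Delta> C \<longleftrightarrow> subcoalgebra sc \<Delta> C \<and> C \<noteq> {0} \<and>
     (\<forall>D. subcoalgebra sc \<Delta> D \<and> D \<subseteq> C \<longrightarrow> D = {0} \<or> D = C)"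

definition pointed :: "('k::field \<Rightarrow> 'h::ring_1 \<Rightarrow> 'h) \<Rightarrow> ('h \<Rightarrow> ('h \<times> 'h) list) \<Rightarrow> bool" where
  "pointed sc \<Delta> \<longleftrightarrow> (\<forall>C. simple_subcoalgebra sc \<Delta> C \<longrightarrow> vector_space.dim sc C = 1)"

end

theory Submission
  imports Defs "HOL-Library.Function_Algebras"
begin

text \<open>Since H is left noetherian, its augmentation ideal is generated, as a left ideal, by a finite set F.
  Let K be a Hopf subalgebra containing F. The map sending h to the tensor of \<open>h\<^sub>1\<close> and
  \<open>S h\<^sub>2\<close> over K is trivial on the augmentation ideal, which forces the tensors of h with 1 and of
  1 with h over K to coincide. If H is faithfully flat over K, this gives \<open>K = H\<close>. If H is pointed,
  then \<open>H/K\<close> is exhausted by free subquotients over K, and again \<open>K = H\<close>. It remains to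
  choose K: the Hopf subalgebra generated by a finite-dimensional subcoalgebra containing F.
  In the pointed case it is affine, because the antipode of such a subcoalgebra C lies in the algebra
  generated by C and the inverses of its group-like elements.

  All computations in tensor products are carried out by means of scalar-valued multilinear forms, which
  separate tensors.\<close>

section \<open>Linear functionals and tensors\<close>

text \<open>Under (FF) the conclusion is drawn in the tensor product of H and H/K over K: there the
  tensor of h with 1 becomes zero, hence so does that of 1 with h, and faithful flatness kills the
  class of h in H/K. In the pointed case flatness is not given, and a coarser target is used. With
  K^+ the kernel of \<epsilon> on K, the left factor H is sent to the scalars by \<epsilon>, so it
  is enough that H/(K + K^+ H) is nonzero. This is what the free subquotients provide. The antipode
  is the obstacle to affineness: there is no a priori bound on the powers S^i(C) needed to generate
  the Hopf subalgebra of a finite-dimensional subcoalgebra C, so in general only S-finite type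
  results. The list \<open>\<Delta> x\<close> is an arbitrary representative whose single entries
  carry no information. The arguments therefore use multilinear forms and slices, which depend on
  the tensor alone.\<close>

context vector_space
begin

lemma lin_functional_iff:
  "lin_functional scale f \<longleftrightarrow>
     (\<forall>x y. f (x + y) = f x + f y) \<and> (\<forall>c x. f (scale c x) = c * f x)"
proof -
  have "vector_space ((*) :: 'a \<Rightarrow> 'a \<Rightarrow> 'a)"
    by unfold_locales (auto simp: algebra_simps)
  then show ?thesis
    using vector_space_axioms unfolding lin_functional_def Vector_Spaces.linear_iff by auto
qed

lemma lin_functional_add: "lin_functional scale f \<Longrightarrow> f (x + y) = f x + f y"
  and lin_functional_scale: "lin_functional scale f \<Longrightarrow> f (scale c x) = c * f x"
  by (auto simp: lin_functional_iff)

lemma lin_functional_0: "lin_functional scale f \<Longrightarrow> f 0 = 0"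
  using lin_functional_scale[of f 0 0] by simp

lemma lin_functional_minus: "lin_functional scale f \<Longrightarrow> f (- x) = - f x"
  using lin_functional_add[of f x "- x"] lin_functional_0[of f]
  by (simp add: eq_neg_iff_add_eq_0 add.commute)

lemma lin_functional_diff: "lin_functional scale f \<Longrightarrow> f (x - y) = f x - f y"
  using lin_functional_add[of f x "- y"] lin_functional_minus[of f y] by simp

lemma lin_functional_sum: "lin_functional scale f \<Longrightarrow> f (\<Sum>i\<in>A. g i) = (\<Sum>i\<in>A. f (g i))"
  by (induction A rule: infinite_finite_induct) (auto simp: lin_functional_add lin_functional_0)

lemma lin_functional_sum_list:
  "lin_functional scale f \<Longrightarrow> f (sum_list (map g xs)) = sum_list (map (\<lambda>x. f (g x)) xs)"
  by (induction xs) (auto simp: lin_functional_add lin_functional_0)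

lemma lin_functional_representation:
  "independent B \<Longrightarrow> span B = UNIV \<Longrightarrow> lin_functional scale (\<lambda>v. representation B v b)"
  unfolding lin_functional_iff by (auto simp: representation_add representation_scale)

lemma separating_functional:
  assumes Z: "subspace Z" and e: "e \<notin> Z"
  obtains f where "lin_functional scale f" "\<And>z. z \<in> Z \<Longrightarrow> f z = 0" "f e = 1"
proof -
  obtain B where B: "B \<subseteq> Z" "independent B" "Z \<subseteq> span B" "card B = dim Z"
    using basis_exists by blast
  have sB: "span B = Z" using B Z by (meson span_minimal subset_antisym)
  then have ind: "independent (insert e B)" using B(2) e by (simp add: independent_insert)
  define E where "E = extend_basis (insert e B)"
  have E: "independent E" "span E = UNIV" "insert e B \<subseteq> E"
    using ind extend_basis_superset independent_extend_basis span_extend_basis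
    unfolding E_def by auto
  show ?thesis
  proof
    show "lin_functional scale (\<lambda>v. representation E v e)"
      using E by (intro lin_functional_representation)
    show "representation E e e = 1"
      using E by (simp add: representation_basis)
    fix z assume z: "z \<in> Z"
    then have "representation E z = representation B z"
      using E sB by (intro representation_extend) auto
    moreover have "e \<notin> B" using B(1) e by blast
    ultimately show "representation E z e = 0"
      using representation_ne_zero[of B z e] by auto
  qed
qed

lemma eq_by_functionals:
  assumes "\<And>f. lin_functional scale f \<Longrightarrow> f x = f y"
  shows "x = y"
proof (rule ccontr)
  assume "x \<noteq> y"
  then have "x - y \<notin> {0}" by simp
  then obtain f where f: "lin_functional scale f" "f (x - y) = 1"
    using separating_functional[OF subspace_single_0] by metis
  then show False using assms[OF f(1)] by (simp add: lin_functional_diff)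
qed

text \<open>The coordinates are taken in a basis of the whole space that extends one of X; this
  makes them functionals on the whole space and not only on X.\<close>

lemma dual_basis:
  assumes "subspace X" "X \<subseteq> span A" "finite A"
  obtains E f where "finite E" "E \<subseteq> X" "\<And>b. lin_functional scale (f b)"
    "\<And>x. x \<in> X \<Longrightarrow> x = (\<Sum>b\<in>E. scale (f b x) b)"
proof -
  obtain B where B: "B \<subseteq> X" "independent B" "X \<subseteq> span B" "card B = dim X"
    using basis_exists by blast
  have fin: "finite B" using independent_span_bound[OF assms(3) B(2)] B(1) assms(2) by auto
  have E: "independent (extend_basis B)" "span (extend_basis B) = UNIV" "B \<subseteq> extend_basis B"
    using B(2) extend_basis_superset independent_extend_basis span_extend_basis by auto
  show ?thesis
  proof
    show "finite B" "B \<subseteq> X" by fact+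
    show "lin_functional scale (\<lambda>v. representation (extend_basis B) v b)" for b
      using E by (intro lin_functional_representation)
    fix x assume "x \<in> X"
    then have x: "x \<in> span B" using B by auto
    then have "representation (extend_basis B) x = representation B x"
      using E by (intro representation_extend) auto
    then show "x = (\<Sum>b\<in>B. scale (representation (extend_basis B) x b) b)"
      using sum_representation_eq[OF B(2) x fin] by simp
  qed
qed

text \<open>A member of least dimension is minimal, since nested finite-dimensional subspaces of
  equal dimension coincide. It will be applied to nonzero subcoalgebras and to left
  coideals.\<close>

lemma exists_minimal_subspace:
  assumes P: "P C" and sub: "\<And>D. P D \<Longrightarrow> subspace D" and C: "C \<subseteq> span A" "finite A"
  obtains E where "P E" "E \<subseteq> C" "\<And>D. P D \<Longrightarrow> D \<subseteq> E \<Longrightarrow> D = E"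
proof -
  obtain E where E: "P E \<and> E \<subseteq> C" and min: "\<And>D. P D \<and> D \<subseteq> C \<Longrightarrow> dim E \<le> dim D"
    using ex_has_least_nat[of "\<lambda>D. P D \<and> D \<subseteq> C" C dim] P by auto
  show ?thesis
  proof
    show "P E" "E \<subseteq> C" using E by auto
    fix D assume D: "P D" "D \<subseteq> E"
    obtain B where B: "B \<subseteq> D" "independent B" "D \<subseteq> span B" "card B = dim D"
      using basis_exists by blast
    obtain B' where B': "B \<subseteq> B'" "B' \<subseteq> E" "independent B'" "E \<subseteq> span B'"
      using maximal_independent_subset_extend[of B E] B D by blast
    have fin: "finite B'" using independent_span_bound[OF C(2) B'(3)] B'(2) E C(1) by auto
    have "card B' = dim E" using B' by (intro basis_card_eq_dim)
    then have "card B' \<le> card B" using min[of D] D E B by auto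
    then have "B = B'" using fin B'(1) card_seteq by blast
    then have "E \<subseteq> D" using B'(4) B(1) sub[OF D(1)] span_minimal by blast
    then show "D = E" using D by auto
  qed
qed

text \<open>\<open>tens_eq\<close> tests only products f(a) g(b). On the finite-dimensional span of
  the first entries a dual basis writes B as a finite sum of such products, so every bilinear form
  is covered.\<close>

lemma tens_eq_bilinear:
  fixes B :: "'b \<Rightarrow> 'b \<Rightarrow> 'a"
  assumes tu: "tens_eq scale t u"
    and B: "\<And>a. lin_functional scale (B a)" "\<And>b. lin_functional scale (\<lambda>a. B a b)"
  shows "(\<Sum>(a,b)\<leftarrow>t. B a b) = (\<Sum>(a,b)\<leftarrow>u. B a b)"
proof -
  define A where "A = fst ` set (t @ u)"
  have fin: "finite A" unfolding A_def by simp
  obtain E f where E: "finite E" "E \<subseteq> span A" "\<And>b. lin_functional scale (f b)"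
    "\<And>x. x \<in> span A \<Longrightarrow> x = (\<Sum>b\<in>E. scale (f b x) b)"
    by (rule dual_basis[OF subspace_span subset_refl fin]) (rule that)
  have *: "(\<Sum>(a,b)\<leftarrow>v. B a b) = (\<Sum>e\<in>E. \<Sum>(a,b)\<leftarrow>v. f e a * B e b)" if "fst ` set v \<subseteq> A" for v
    using that
  proof (induction v)
    case (Cons p v)
    obtain a b where p: "p = (a, b)" by (cases p)
    have a: "a \<in> span A" using Cons.prems p by (auto intro: span_base)
    have "B a b = B (\<Sum>e\<in>E. scale (f e a) e) b" using E(4)[OF a] by simp
    also have "\<dots> = (\<Sum>e\<in>E. f e a * B e b)"
      by (simp add: lin_functional_sum[OF B(2)] lin_functional_scale[OF B(2)])
    finally show ?case using Cons p by (simp add: sum.distrib)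
  qed simp
  have "(\<Sum>(a,b)\<leftarrow>t. f e a * B e b) = (\<Sum>(a,b)\<leftarrow>u. f e a * B e b)" for e
    using tu E(3) B(1) unfolding tens_eq_def by blast
  moreover have "fst ` set t \<subseteq> A" "fst ` set u \<subseteq> A" by (auto simp: A_def)
  ultimately show ?thesis by (simp only: *)
qed

lemma tens3_eq_trilinear:
  fixes T :: "'b \<Rightarrow> 'b \<Rightarrow> 'b \<Rightarrow> 'a"
  assumes tu: "tens3_eq scale t u"
    and T: "\<And>a b. lin_functional scale (T a b)" "\<And>a c. lin_functional scale (\<lambda>b. T a b c)"
      "\<And>b c. lin_functional scale (\<lambda>a. T a b c)"
  shows "(\<Sum>(a,b,c)\<leftarrow>t. T a b c) = (\<Sum>(a,b,c)\<leftarrow>u. T a b c)"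
proof -
  define A where "A = fst ` set (t @ u) \<union> (fst \<circ> snd) ` set (t @ u)"
  have fin: "finite A" unfolding A_def by simp
  obtain E f where E: "finite E" "E \<subseteq> span A" "\<And>b. lin_functional scale (f b)"
    "\<And>x. x \<in> span A \<Longrightarrow> x = (\<Sum>b\<in>E. scale (f b x) b)"
    by (rule dual_basis[OF subspace_span subset_refl fin]) (rule that)
  have *: "(\<Sum>(a,b,c)\<leftarrow>v. T a b c) = (\<Sum>e\<in>E. \<Sum>e'\<in>E. \<Sum>(a,b,c)\<leftarrow>v. f e a * f e' b * T e e' c)"
    if "fst ` set v \<union> (fst \<circ> snd) ` set v \<subseteq> A" for v
    using that
  proof (induction v)
    case (Cons p v)
    obtain a b c where p: "p = (a, b, c)" by (cases p)
    have a: "a \<in> span A" "b \<in> span A" using Cons.prems p by (auto intro: span_base)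
    have "T a b c = T (\<Sum>e\<in>E. scale (f e a) e) b c" using E(4)[OF a(1)] by simp
    also have "\<dots> = (\<Sum>e\<in>E. f e a * T e b c)"
      by (simp add: lin_functional_sum[OF T(3)] lin_functional_scale[OF T(3)])
    also have "\<dots> = (\<Sum>e\<in>E. f e a * T e (\<Sum>e'\<in>E. scale (f e' b) e') c)"
      using E(4)[OF a(2)] by simp
    also have "\<dots> = (\<Sum>e\<in>E. \<Sum>e'\<in>E. f e a * f e' b * T e e' c)"
      by (simp add: lin_functional_sum[OF T(2)] lin_functional_scale[OF T(2)]
        sum_distrib_left mult.assoc)
    finally show ?case using Cons p by (simp add: sum.distrib)
  qed simp
  have "(\<Sum>(a,b,c)\<leftarrow>t. f e a * f e' b * T e e' c)
      = (\<Sum>(a,b,c)\<leftarrow>u. f e a * f e' b * T e e' c)" for e e'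
    using tu E(3) T(1) unfolding tens3_eq_def by blast
  moreover have "fst ` set t \<union> (fst \<circ> snd) ` set t \<subseteq> A"
    "fst ` set u \<union> (fst \<circ> snd) ` set u \<subseteq> A"
    by (auto simp: A_def)
  ultimately show ?thesis by (simp only: *)
qed

end

section \<open>Sweedler sums and the antipode\<close>

locale hopf =
  fixes sc :: "'k::field \<Rightarrow> 'h::ring_1 \<Rightarrow> 'h"
    and \<Delta> :: "'h \<Rightarrow> ('h \<times> 'h) list"
    and \<epsilon> :: "'h \<Rightarrow> 'k"
    and S :: "'h \<Rightarrow> 'h"
  assumes hopf: "hopf_algebra sc \<Delta> \<epsilon> S"

sublocale hopf \<subseteq> vector_space sc
  using hopf by (simp add: hopf_algebra_def)

context hopf
begin

abbreviation linf :: "('h \<Rightarrow> 'k) \<Rightarrow> bool" where "linf \<equiv> lin_functional sc"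

lemma sc_mult_left [simp]: "sc c x * y = sc c (x * y)"
  and sc_mult_right [simp]: "x * sc c y = sc c (x * y)"
proof -
  have "sc c (x * y) = sc c x * y \<and> sc c (x * y) = x * sc c y"
    using hopf unfolding hopf_algebra_def by blast
  then show "sc c x * y = sc c (x * y)" "x * sc c y = sc c (x * y)" by auto
qed

lemma S_add: "S (x + y) = S x + S y" and S_scale: "S (sc c x) = sc c (S x)"
  using hopf unfolding hopf_algebra_def Vector_Spaces.linear_iff by blast+

lemma linf_counit: "linf \<epsilon>" and counit_mult: "\<epsilon> (x * y) = \<epsilon> x * \<epsilon> y" and counit_1: "\<epsilon> 1 = 1"
  using hopf unfolding hopf_algebra_def by blast+

text \<open>Sweedler notation: the sum of B(x1, x2). Its value is independent of the chosen list
  only for bilinear B. The general codomain serves scalar forms and H-valued expressions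
  alike.\<close>

definition sw :: "('h \<Rightarrow> 'h \<Rightarrow> 'b::comm_monoid_add) \<Rightarrow> 'h \<Rightarrow> 'b" where
  "sw B x = (\<Sum>(a,b)\<leftarrow>\<Delta> x. B a b)"

definition bilin :: "('h \<Rightarrow> 'h \<Rightarrow> 'k) \<Rightarrow> bool" where
  "bilin B \<longleftrightarrow> (\<forall>a. linf (B a)) \<and> (\<forall>b. linf (\<lambda>a. B a b))"

definition trilin :: "('h \<Rightarrow> 'h \<Rightarrow> 'h \<Rightarrow> 'k) \<Rightarrow> bool" where
  "trilin T \<longleftrightarrow> (\<forall>a. bilin (T a)) \<and> (\<forall>b c. linf (\<lambda>a. T a b c))"

lemma sw_plus: "sw (\<lambda>a b. F a b + G a b) = (\<lambda>x. sw F x + sw G x)"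
  unfolding sw_def by (simp add: case_prod_unfold sum_list_addf)

lemma sw_cmult: "sw (\<lambda>a b. c * F a b) = (\<lambda>x. c * sw F x)"
  for F :: "'h \<Rightarrow> 'h \<Rightarrow> 'b::semiring_0"
  unfolding sw_def by (simp add: case_prod_unfold sum_list_const_mult)

lemma sw_multc: "sw (\<lambda>a b. F a b * c) = (\<lambda>x. sw F x * c)"
  for F :: "'h \<Rightarrow> 'h \<Rightarrow> 'b::semiring_0"
  unfolding sw_def by (simp add: case_prod_unfold sum_list_mult_const)

lemma sw_linf: "linf f \<Longrightarrow> f (sw B x) = sw (\<lambda>a b. f (B a b)) x"
  unfolding sw_def case_prod_unfold by (rule lin_functional_sum_list)

lemma sum_list_swap:
  "(\<Sum>x\<leftarrow>xs. \<Sum>y\<leftarrow>ys. f x y) = (\<Sum>y\<leftarrow>ys. \<Sum>x\<leftarrow>xs. f x y)"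
  for f :: "'c \<Rightarrow> 'd \<Rightarrow> 'e::comm_monoid_add"
  by (induction xs) (auto simp: sum_list_addf)

lemma sum_list_concat_map:
  "sum_list (concat (map f xs)) = (\<Sum>x\<leftarrow>xs. sum_list (f x))"
  for f :: "'c \<Rightarrow> 'e::comm_monoid_add list"
  by (induction xs) auto

lemma sw_swap:
  "sw (\<lambda>a b. sw (\<lambda>c d. F a b c d) y) x = sw (\<lambda>c d. sw (\<lambda>a b. F a b c d) x) y"
  unfolding sw_def case_prod_unfold by (rule sum_list_swap)

lemma linf_sw_param: "(\<And>a b. linf (\<lambda>z. F a b z)) \<Longrightarrow> linf (\<lambda>z. sw (\<lambda>a b. F a b z) x)"
  by (auto simp: lin_functional_iff sw_plus sw_cmult)

lemma bilinD: "bilin B \<Longrightarrow> linf (B a)" "bilin B \<Longrightarrow> linf (\<lambda>a. B a b)"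
  by (auto simp: bilin_def)

lemma tens_bilin:
  assumes "tens_eq sc t u" "bilin B"
  shows "(\<Sum>(a,b)\<leftarrow>t. B a b) = (\<Sum>(a,b)\<leftarrow>u. B a b)"
  using assms by (intro tens_eq_bilinear) (auto simp: bilin_def)

lemma tens_bilin_valued:
  assumes "tens_eq sc t u" "\<And>f. linf f \<Longrightarrow> bilin (\<lambda>a b. f (B a b))"
  shows "(\<Sum>(a,b)\<leftarrow>t. B a b) = (\<Sum>(a,b)\<leftarrow>u. B a b)"
proof (rule eq_by_functionals)
  fix f assume f: "linf f"
  show "f (\<Sum>(a,b)\<leftarrow>t. B a b) = f (\<Sum>(a,b)\<leftarrow>u. B a b)"
    using tens_bilin[OF assms(1) assms(2)[OF f]]
    by (simp add: case_prod_unfold lin_functional_sum_list[OF f])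
qed

lemma linf_sw:
  assumes "bilin B"
  shows "linf (sw B)"
proof -
  have "tens_eq sc (\<Delta> (x + y)) (\<Delta> x @ \<Delta> y)" for x y
    using hopf unfolding hopf_algebra_def by blast
  from tens_bilin[OF this assms] have "sw B (x + y) = sw B x + sw B y" for x y
    by (simp add: sw_def)
  moreover have "tens_eq sc (\<Delta> (sc c x)) (map (\<lambda>(a,b). (sc c a, b)) (\<Delta> x))" for c x
    using hopf unfolding hopf_algebra_def by blast
  from tens_bilin[OF this assms] have "sw B (sc c x) = sw (\<lambda>a b. B (sc c a) b) x" for c x
    by (simp add: sw_def case_prod_unfold o_def)
  then have "sw B (sc c x) = c * sw B x" for c x
    using lin_functional_scale[OF bilinD(2)[OF assms]] sw_cmult[of c B] by simp
  ultimately show ?thesis by (simp add: lin_functional_iff)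
qed

lemma sw_coassoc:
  assumes "trilin T"
  shows "sw (\<lambda>a b. sw (\<lambda>c d. T c d b) a) x = sw (\<lambda>a b. sw (\<lambda>c d. T a c d) b) x"
proof -
  have "tens3_eq sc
        (concat (map (\<lambda>(a,b). map (\<lambda>(c,d). (c,d,b)) (\<Delta> a)) (\<Delta> x)))
        (concat (map (\<lambda>(a,b). map (\<lambda>(c,d). (a,c,d)) (\<Delta> b)) (\<Delta> x)))"
    using hopf unfolding hopf_algebra_def by blast
  then have "(\<Sum>(a,b,c)\<leftarrow>concat (map (\<lambda>(a,b). map (\<lambda>(c,d). (c,d,b)) (\<Delta> a)) (\<Delta> x)). T a b c)
    = (\<Sum>(a,b,c)\<leftarrow>concat (map (\<lambda>(a,b). map (\<lambda>(c,d). (a,c,d)) (\<Delta> b)) (\<Delta> x)). T a b c)"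
    by (rule tens3_eq_trilinear) (use assms in \<open>auto simp: trilin_def bilin_def\<close>)
  then show ?thesis
    by (simp add: sw_def case_prod_unfold o_def map_concat sum_list_concat_map)
qed

lemma sw_counit_left: "linf f \<Longrightarrow> sw (\<lambda>a b. \<epsilon> a * f b) x = f x"
  and sw_counit_right: "linf f \<Longrightarrow> sw (\<lambda>a b. \<epsilon> b * f a) x = f x"
proof -
  assume f: "linf f"
  have "(\<Sum>(a,b)\<leftarrow>\<Delta> x. sc (\<epsilon> a) b) = x" "(\<Sum>(a,b)\<leftarrow>\<Delta> x. sc (\<epsilon> b) a) = x"
    using hopf unfolding hopf_algebra_def by blast+
  then have "f (\<Sum>(a,b)\<leftarrow>\<Delta> x. sc (\<epsilon> a) b) = f x" "f (\<Sum>(a,b)\<leftarrow>\<Delta> x. sc (\<epsilon> b) a) = f x" by simp_all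
  then show "sw (\<lambda>a b. \<epsilon> a * f b) x = f x" "sw (\<lambda>a b. \<epsilon> b * f a) x = f x"
    by (simp_all add: sw_def case_prod_unfold lin_functional_sum_list[OF f] lin_functional_scale[OF f])
qed

lemma sw_antipode_left: "sw (\<lambda>a b. S a * b) x = sc (\<epsilon> x) 1"
  and sw_antipode_right: "sw (\<lambda>a b. a * S b) x = sc (\<epsilon> x) 1"
  using hopf unfolding hopf_algebra_def sw_def by blast+

lemma sw_mult:
  assumes "bilin B"
  shows "sw B (x * y) = sw (\<lambda>a b. sw (\<lambda>c d. B (a * c) (b * d)) y) x"
proof -
  have "tens_eq sc (\<Delta> (x * y))
        (concat (map (\<lambda>(a,b). map (\<lambda>(c,d). (a * c, b * d)) (\<Delta> y)) (\<Delta> x)))"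
    using hopf unfolding hopf_algebra_def by blast
  from tens_bilin[OF this assms] show ?thesis
    by (simp add: sw_def case_prod_unfold o_def map_concat sum_list_concat_map)
qed

lemma sw_1: "bilin B \<Longrightarrow> sw B 1 = B 1 1"
proof -
  assume B: "bilin B"
  have "tens_eq sc (\<Delta> 1) [(1, 1)]" using hopf unfolding hopf_algebra_def by blast
  from tens_bilin[OF this B] show ?thesis by (simp add: sw_def)
qed

lemma linf_comp:
  "linf f \<Longrightarrow> linf (\<lambda>x. f (x * y))" "linf f \<Longrightarrow> linf (\<lambda>x. f (y * x))" "linf f \<Longrightarrow> linf (\<lambda>x. f (S x))"
  "linf f \<Longrightarrow> linf (\<lambda>x. c * f x)" "linf f \<Longrightarrow> linf (\<lambda>x. f x * c)"
  by (auto simp: lin_functional_iff algebra_simps S_add S_scale)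

lemmas linf_simps = lin_functional_iff sw_plus sw_cmult algebra_simps S_add S_scale

section \<open>Anti-multiplicativity of the antipode\<close>

lemma S_1: "S 1 = 1"
proof (rule eq_by_functionals)
  fix f assume f: "linf f"
  have "bilin (\<lambda>a b. f (S a * b))" using f by (simp add: bilin_def linf_simps)
  then have "sw (\<lambda>a b. f (S a * b)) 1 = f (S 1 * 1)" by (rule sw_1)
  then show "f (S 1) = f 1"
    using sw_linf[OF f, of "\<lambda>a b. S a * b" 1]
    by (simp add: sw_antipode_left counit_1)
qed

lemma sw_antipode_linf:
  assumes "linf f"
  shows "sw (\<lambda>a b. f (u * S a * b * v)) x = \<epsilon> x * f (u * v)"
    and "sw (\<lambda>a b. f (u * a * S b * v)) x = \<epsilon> x * f (u * v)"
proof -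
  have f: "linf (\<lambda>z. f (u * z * v))" using assms by (simp add: linf_simps)
  show "sw (\<lambda>a b. f (u * S a * b * v)) x = \<epsilon> x * f (u * v)"
    using sw_linf[OF f, of "\<lambda>a b. S a * b" x]
    by (simp add: sw_antipode_left lin_functional_scale[OF assms] mult.assoc)
  show "sw (\<lambda>a b. f (u * a * S b * v)) x = \<epsilon> x * f (u * v)"
    using sw_linf[OF f, of "\<lambda>a b. a * S b" x]
    by (simp add: sw_antipode_right lin_functional_scale[OF assms] mult.assoc)
qed

text \<open>Both \<open>S (x * y)\<close> and \<open>S y * S x\<close> are convolution inverses of the multiplication.\<close>

lemma S_mult: "S (x * y) = S y * S x"
proof (rule eq_by_functionals)
  fix f assume f: "linf f"
  \<comment> \<open>Both sides are evaluations of S(x1 y1) x2 y2 S(y3) S(x3) under f: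
    \<open>M\<close> groups S(x1 y1) x2 y2, which collapses to counits; \<open>N\<close> is fully
    expanded, so that y2 S(y3) and then x2 S(x3) collapse instead.\<close>
  define G where "G p q d b = f (S p * q * S d * S b)" for p q d b
  define M where "M a b c d = sw (\<lambda>p q. G p q d b) (a * c)" for a b c d
  define N where "N a b1 b2 c d1 d2 = f (S (a * c) * b1 * d1 * S d2 * S b2)" for a b1 b2 c d1 d2
  have Gb: "bilin (\<lambda>p q. G p q d b)" for d b using f by (simp add: G_def bilin_def linf_simps)
  have "f (S y * S x) = sw (\<lambda>a b. sw (\<lambda>c d. M a b c d) y) x"
  proof -
    have M: "M a b c d = \<epsilon> a * (\<epsilon> c * f (S d * S b))" for a b c d
      using sw_antipode_linf(1)[OF f, of 1 "S d * S b" "a * c"]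
      by (simp add: M_def G_def counit_mult mult.assoc)
    have "linf (\<lambda>d. f (S d * S b))" for b using f by (simp add: linf_simps)
    from sw_counit_left[OF this]
    have "sw (\<lambda>c d. M a b c d) y = \<epsilon> a * f (S y * S b)" for a b
      unfolding M sw_cmult by simp
    moreover have "linf (\<lambda>b. f (S y * S b))" using f by (simp add: linf_simps)
    from sw_counit_left[OF this] have "sw (\<lambda>a b. \<epsilon> a * f (S y * S b)) x = f (S y * S x)" .
    ultimately show ?thesis by simp
  qed
  also have "\<dots> = sw (\<lambda>a b. sw (\<lambda>b1 b2. sw (\<lambda>c d. sw (\<lambda>d1 d2. N a b1 b2 c d1 d2) d) y) b) x"
  proof -
    have MN: "M a b c d = sw (\<lambda>a1 a2. sw (\<lambda>c1 c2. N a1 a2 b c1 c2 d) c) a" for a b c d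
      unfolding M_def sw_mult[OF Gb] by (simp add: G_def N_def mult.assoc)
    have "sw (\<lambda>a b. sw (\<lambda>c d. M a b c d) y) x =
      sw (\<lambda>a b. sw (\<lambda>c d. sw (\<lambda>a1 a2. sw (\<lambda>c1 c2. N a1 a2 b c1 c2 d) c) a) y) x"
      by (simp add: MN)
    also have "\<dots> = sw (\<lambda>a b. sw (\<lambda>a1 a2. sw (\<lambda>c d. sw (\<lambda>c1 c2. N a1 a2 b c1 c2 d) c) y) a) x"
      by (intro arg_cong2[where f = sw] ext refl sw_swap)
    also have "\<dots> = sw (\<lambda>a b. sw (\<lambda>a1 a2. sw (\<lambda>c d. sw (\<lambda>d1 d2. N a1 a2 b c d1 d2) d) y) a) x"
    proof -
      have "trilin (\<lambda>c1 c2 d. N a1 a2 b c1 c2 d)" for a1 a2 b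
        using f by (simp add: N_def trilin_def bilin_def linf_simps)
      from sw_coassoc[OF this] show ?thesis by simp
    qed
    also have "\<dots> = sw (\<lambda>a b. sw (\<lambda>b1 b2. sw (\<lambda>c d. sw (\<lambda>d1 d2. N a b1 b2 c d1 d2) d) y) b) x"
    proof -
      have "trilin (\<lambda>a1 a2 b. sw (\<lambda>c d. sw (\<lambda>d1 d2. N a1 a2 b c d1 d2) d) y)"
        using f by (simp add: N_def trilin_def bilin_def linf_simps)
      from sw_coassoc[OF this] show ?thesis by simp
    qed
    finally show ?thesis .
  qed
  also have "\<dots> = f (S (x * y))"
  proof -
    have 1: "sw (\<lambda>d1 d2. N a b1 b2 c d1 d2) d = \<epsilon> d * f (S (a * c) * b1 * S b2)" for a b1 b2 c d
      using sw_antipode_linf(2)[OF f, of "S (a * c) * b1" "S b2" d] by (simp add: N_def mult.assoc)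
    have "linf (\<lambda>c. f (S (a * c) * b1 * S b2))" for a b1 b2 using f by (simp add: linf_simps)
    from sw_counit_right[OF this]
    have 2: "sw (\<lambda>c d. sw (\<lambda>d1 d2. N a b1 b2 c d1 d2) d) y = f (S (a * y) * b1 * S b2)" for a b1 b2
      by (simp add: 1)
    have 3: "sw (\<lambda>b1 b2. f (S (a * y) * b1 * S b2)) b = \<epsilon> b * f (S (a * y))" for a b
      using sw_antipode_linf(2)[OF f, of "S (a * y)" 1 b] by simp
    have "linf (\<lambda>a. f (S (a * y)))" using f by (simp add: linf_simps)
    from sw_counit_right[OF this] show ?thesis by (simp add: 2 3)
  qed
  finally show "f (S (x * y)) = f (S y * S x)" by simp
qed

section \<open>Slices, subcoalgebras and the finiteness theorem\<close>

text \<open>Both sides are convolution inverses of the comultiplication.\<close>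

lemma S_comult:
  assumes B: "bilin B"
  shows "sw B (S x) = sw (\<lambda>a b. B (S b) (S a)) x"
proof -
  have B': "linf (B a)" "linf (\<lambda>a. B a b)" for a b using B by (auto simp: bilin_def)
  \<comment> \<open>\<open>\<Phi> b z\<close> is B evaluated on the coproduct of z times the tensor
    of S(b2) and S(b1). With z = S(x1) x2 and b = x3 it is computed twice: cancelling S(x1) x2
    leaves B(S(x2), S(x1)), while cancelling x2 against the legs of x3 leaves B on the coproduct of
    S(x).\<close>
  define G where "G u v b = sw (\<lambda>c d. B (u * S d) (v * S c)) b" for u v b
  define \<Phi> where "\<Phi> b z = sw (\<lambda>u v. G u v b) z" for b z
  have "bilin (\<lambda>c d. B (u * S d) (v * S c))" for u v
    using B' by (simp add: bilin_def linf_simps)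
  then have G3: "linf (\<lambda>b. G u v b)" for u v unfolding G_def by (rule linf_sw)
  have G12: "bilin (\<lambda>u v. G u v b)" for b
    using B' by (simp add: G_def bilin_def linf_simps)
  have \<Phi>2: "linf (\<Phi> b)" for b unfolding \<Phi>_def using G12 by (rule linf_sw)
  have \<Phi>1: "linf (\<lambda>b. \<Phi> b z)" for z unfolding \<Phi>_def using G3 by (rule linf_sw_param)
  have "sw (\<lambda>a b. sw (\<lambda>p q. \<Phi> b (S p * q)) a) x = sw (\<lambda>a b. \<epsilon> a * G 1 1 b) x"
  proof -
    have "\<Phi> b 1 = G 1 1 b" for b unfolding \<Phi>_def by (rule sw_1[OF G12])
    then have "sw (\<lambda>p q. \<Phi> b (S p * q)) a = \<epsilon> a * G 1 1 b" for a b
      using sw_linf[OF \<Phi>2, of b "\<lambda>p q. S p * q" a]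
      by (simp add: sw_antipode_left lin_functional_scale[OF \<Phi>2])
    then show ?thesis by simp
  qed
  also have "\<dots> = G 1 1 x" using G3 by (rule sw_counit_left)
  finally have 1: "sw (\<lambda>a b. sw (\<lambda>p q. \<Phi> b (S p * q)) a) x = sw (\<lambda>a b. B (S b) (S a)) x"
    by (simp add: G_def)
  have "sw (\<lambda>a b. sw (\<lambda>p q. \<Phi> b (S p * q)) a) x = sw (\<lambda>a b. sw (\<lambda>p q. \<Phi> q (S a * p)) b) x"
    by (rule sw_coassoc) (use \<Phi>1 \<Phi>2 in \<open>simp add: trilin_def bilin_def linf_simps\<close>)
  also have "\<dots> = sw (\<lambda>a b. \<epsilon> b * sw B (S a)) x"
  proof -
    \<comment> \<open>In legs this is B(u b1 S(b4), v b2 S(b3)). The inner pair b2 S(b3) has to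
      vanish first; only then do b1 and S(b4) become adjacent.\<close>
    have "sw (\<lambda>p q. sw (\<lambda>s t. G (u * s) (v * t) q) p) b = \<epsilon> b * B u v" for u v b
    proof -
      define T where "T s t c d = B (u * s * S d) (v * t * S c)" for s t c d
      have T: "linf (T s t c)" "linf (\<lambda>c. T s t c d)" "linf (\<lambda>t. T s t c d)" "linf (\<lambda>s. T s t c d)"
        for s t c d using B' by (simp_all add: T_def linf_simps)
      have "linf (\<lambda>q. sw (\<lambda>c d. T s t c d) q)" for s t
        using T by (intro linf_sw) (simp add: bilin_def)
      then have "trilin (\<lambda>s t q. sw (\<lambda>c d. T s t c d) q)"
        using T unfolding trilin_def bilin_def by (intro conjI allI linf_sw_param) auto
      from sw_coassoc[OF this]
      have "sw (\<lambda>p q. sw (\<lambda>s t. G (u * s) (v * t) q) p) b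
        = sw (\<lambda>s r. sw (\<lambda>t q. sw (\<lambda>c d. T s t c d) q) r) b"
        by (simp add: G_def T_def)
      also have "\<dots> = sw (\<lambda>s r. sw (\<lambda>q d. sw (\<lambda>t c. T s t c d) q) r) b"
      proof -
        have "trilin (\<lambda>t c d. T s t c d)" for s using T by (simp add: trilin_def bilin_def)
        from sw_coassoc[OF this] show ?thesis by simp
      qed
      also have "\<dots> = sw (\<lambda>s r. B (u * s * S r) v) b"
      proof -
        have *: "sw (\<lambda>t c. T s t c d) q = \<epsilon> q * B (u * s * S d) v" for s d q
          using sw_antipode_linf(2)[OF B'(1), of "u * s * S d" v 1 q] by (simp add: T_def)
        have "linf (\<lambda>d. B (u * s * S d) v)" for s using B' by (simp add: linf_simps)
        from sw_counit_left[OF this] show ?thesis unfolding * by simp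
      qed
      also have "\<dots> = \<epsilon> b * B u v"
        using sw_antipode_linf(2)[where f = "\<lambda>z. B z v" and u = u and v = 1 and x = b, OF B'(2)] by simp
      finally show ?thesis .
    qed
    moreover have "\<Phi> q (S a * p) = sw (\<lambda>u v. sw (\<lambda>s t. G (u * s) (v * t) q) p) (S a)" for a p q
      unfolding \<Phi>_def by (rule sw_mult[OF G12])
    ultimately have "sw (\<lambda>p q. \<Phi> q (S a * p)) b = \<epsilon> b * sw B (S a)" for a b
      using sw_swap[of "\<lambda>p q u v. sw (\<lambda>s t. G (u * s) (v * t) q) p" "S a" b]
      by (simp add: sw_cmult)
    then show ?thesis by simp
  qed
  also have "\<dots> = sw B (S x)"
    by (rule sw_counit_right) (use linf_sw[OF B] in \<open>simp add: linf_simps\<close>)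
  finally show ?thesis using 1 by simp
qed

text \<open>The two actions of the dual algebra on H: left and right coideals are the subspaces stable under \<open>lsl\<close>
  and \<open>rsl\<close>, respectively.\<close>

definition lsl :: "('h \<Rightarrow> 'k) \<Rightarrow> 'h \<Rightarrow> 'h" where
  "lsl h = sw (\<lambda>a b. sc (h a) b)"

definition rsl :: "('h \<Rightarrow> 'k) \<Rightarrow> 'h \<Rightarrow> 'h" where
  "rsl h = sw (\<lambda>a b. sc (h b) a)"

lemma linf_lsl: "linf g \<Longrightarrow> g (lsl h x) = sw (\<lambda>a b. h a * g b) x"
  by (simp add: lsl_def sw_linf lin_functional_scale)

lemma linf_rsl: "linf g \<Longrightarrow> g (rsl h x) = sw (\<lambda>a b. g a * h b) x"
  by (simp add: rsl_def sw_linf lin_functional_scale mult.commute)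

lemma bilin_mult: "linf f \<Longrightarrow> linf g \<Longrightarrow> bilin (\<lambda>a b. f a * g b)"
  by (simp add: bilin_def linf_simps)

lemma trilin_mult: "linf f \<Longrightarrow> linf g \<Longrightarrow> linf h \<Longrightarrow> trilin (\<lambda>a b c. f a * (g b * h c))"
  by (simp add: trilin_def bilin_def linf_simps)

lemma linf_conv: "linf f \<Longrightarrow> linf g \<Longrightarrow> linf (sw (\<lambda>a b. f a * g b))"
  by (intro linf_sw bilin_mult)

lemma lsl_add: "linf h \<Longrightarrow> lsl h (x + y) = lsl h x + lsl h y"
  and lsl_scale: "linf h \<Longrightarrow> lsl h (sc c x) = sc c (lsl h x)"
  and rsl_add: "linf h \<Longrightarrow> rsl h (x + y) = rsl h x + rsl h y"
  and rsl_scale: "linf h \<Longrightarrow> rsl h (sc c x) = sc c (rsl h x)"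
proof -
  assume h: "linf h"
  show "lsl h (x + y) = lsl h x + lsl h y"
    by (rule eq_by_functionals)
      (simp add: linf_lsl lin_functional_add lin_functional_add[OF linf_conv] h)
  show "lsl h (sc c x) = sc c (lsl h x)"
    by (rule eq_by_functionals)
      (simp add: linf_lsl lin_functional_scale lin_functional_scale[OF linf_conv] h)
  show "rsl h (x + y) = rsl h x + rsl h y"
    by (rule eq_by_functionals)
      (simp add: linf_rsl lin_functional_add lin_functional_add[OF linf_conv] h)
  show "rsl h (sc c x) = sc c (rsl h x)"
    by (rule eq_by_functionals)
      (simp add: linf_rsl lin_functional_scale lin_functional_scale[OF linf_conv] h)
qed

lemma lsl_0: "linf h \<Longrightarrow> lsl h 0 = 0" and rsl_0: "linf h \<Longrightarrow> rsl h 0 = 0"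
  using lsl_scale[of h 0 0] rsl_scale[of h 0 0] by auto

lemma lsl_diff: "linf h \<Longrightarrow> lsl h (x - y) = lsl h x - lsl h y"
  using lsl_add[of h "x - y" y] by simp

lemma lsl_fun_add: "lsl (\<lambda>z. h z + h' z) x = lsl h x + lsl h' x"
  by (simp add: lsl_def scale_left_distrib sw_plus)

lemma lsl_fun_scale: "lsl (\<lambda>z. c * h z) x = sc c (lsl h x)"
  by (rule eq_by_functionals) (simp add: linf_lsl lin_functional_scale mult.assoc sw_cmult)

lemma lsl_lsl:
  assumes "linf h" "linf h'"
  shows "lsl h (lsl h' x) = lsl (sw (\<lambda>a b. h' a * h b)) x"
proof (rule eq_by_functionals)
  fix g assume g: "linf g"
  have "g (lsl h (lsl h' x)) = sw (\<lambda>a b. h' a * sw (\<lambda>c d. h c * g d) b) x"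
    using linf_lsl[OF linf_conv[OF assms(1) g]] by (simp add: linf_lsl[OF g])
  also have "\<dots> = sw (\<lambda>a b. sw (\<lambda>c d. h' a * (h c * g d)) b) x"
    by (simp add: sw_cmult)
  also have "\<dots> = sw (\<lambda>a b. sw (\<lambda>c d. h' c * (h d * g b)) a) x"
    by (rule sw_coassoc[symmetric]) (intro trilin_mult assms g)
  also have "\<dots> = g (lsl (sw (\<lambda>a b. h' a * h b)) x)"
    by (simp add: linf_lsl[OF g] sw_multc flip: mult.assoc)
  finally show "g (lsl h (lsl h' x)) = g (lsl (sw (\<lambda>a b. h' a * h b)) x)" .
qed

lemma rsl_rsl:
  assumes "linf h" "linf h'"
  shows "rsl h (rsl h' x) = rsl (sw (\<lambda>a b. h a * h' b)) x"
proof (rule eq_by_functionals)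
  fix g assume g: "linf g"
  have "g (rsl h (rsl h' x)) = sw (\<lambda>a b. sw (\<lambda>c d. g c * h d) a * h' b) x"
    using linf_rsl[OF linf_conv[OF g assms(1)]] by (simp add: linf_rsl[OF g])
  also have "\<dots> = sw (\<lambda>a b. sw (\<lambda>c d. g c * (h d * h' b)) a) x"
    by (simp add: sw_multc flip: mult.assoc)
  also have "\<dots> = sw (\<lambda>a b. sw (\<lambda>c d. g a * (h c * h' d)) b) x"
    by (rule sw_coassoc) (intro trilin_mult assms g)
  also have "\<dots> = g (rsl (sw (\<lambda>a b. h a * h' b)) x)"
    by (simp add: linf_rsl[OF g] sw_cmult)
  finally show "g (rsl h (rsl h' x)) = g (rsl (sw (\<lambda>a b. h a * h' b)) x)" .
qed

lemma rsl_lsl: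
  assumes "linf f" "linf h"
  shows "rsl f (lsl h x) = lsl h (rsl f x)"
proof (rule eq_by_functionals)
  fix g assume g: "linf g"
  have "g (rsl f (lsl h x)) = sw (\<lambda>a b. h a * sw (\<lambda>c d. g c * f d) b) x"
    using linf_lsl[OF linf_conv[OF g assms(1)]] by (simp add: linf_rsl[OF g])
  also have "\<dots> = sw (\<lambda>a b. sw (\<lambda>c d. h a * (g c * f d)) b) x"
    by (simp add: sw_cmult)
  also have "\<dots> = sw (\<lambda>a b. sw (\<lambda>c d. h c * (g d * f b)) a) x"
    by (rule sw_coassoc[symmetric]) (intro trilin_mult assms g)
  also have "\<dots> = sw (\<lambda>a b. sw (\<lambda>c d. h c * g d) a * f b) x"
    by (simp add: sw_multc flip: mult.assoc)
  also have "\<dots> = g (lsl h (rsl f x))"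
    using linf_rsl[OF linf_conv[OF assms(2) g]] by (simp add: linf_lsl[OF g])
  finally show "g (rsl f (lsl h x)) = g (lsl h (rsl f x))" .
qed

lemma lsl_counit: "lsl \<epsilon> x = x" and rsl_counit: "rsl \<epsilon> x = x"
proof -
  show "lsl \<epsilon> x = x"
    by (rule eq_by_functionals) (simp add: linf_lsl sw_counit_left)
  show "rsl \<epsilon> x = x"
  proof (rule eq_by_functionals)
    fix f assume f: "linf f"
    show "f (rsl \<epsilon> x) = f x"
      using sw_counit_right[OF f, of x] by (simp add: linf_rsl[OF f] mult.commute)
  qed
qed

lemma counit_lsl: "linf h \<Longrightarrow> \<epsilon> (lsl h x) = h x"
  and counit_rsl: "linf h \<Longrightarrow> \<epsilon> (rsl h x) = h x"
  using sw_counit_right[of h x] sw_counit_left[of h x]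
  by (simp_all add: linf_lsl[OF linf_counit] linf_rsl[OF linf_counit] mult.commute)

lemma linf_lsl_swap: "linf f \<Longrightarrow> linf h \<Longrightarrow> f (lsl h x) = h (rsl f x)"
  by (simp add: linf_lsl linf_rsl)

lemma lsl_S: "linf h \<Longrightarrow> lsl h (S x) = S (rsl (\<lambda>z. h (S z)) x)"
  and rsl_S: "linf h \<Longrightarrow> rsl h (S x) = S (lsl (\<lambda>z. h (S z)) x)"
proof -
  assume h: "linf h"
  have S: "linf (\<lambda>z. g (S z))" if "linf g" for g using that by (rule linf_comp)
  show "lsl h (S x) = S (rsl (\<lambda>z. h (S z)) x)"
  proof (rule eq_by_functionals)
    fix g assume g: "linf g"
    show "g (lsl h (S x)) = g (S (rsl (\<lambda>z. h (S z)) x))"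
      using linf_rsl[OF S[OF g]] S_comult[OF bilin_mult[OF h g]]
      by (simp add: linf_lsl[OF g] mult.commute)
  qed
  show "rsl h (S x) = S (lsl (\<lambda>z. h (S z)) x)"
  proof (rule eq_by_functionals)
    fix g assume g: "linf g"
    show "g (rsl h (S x)) = g (S (lsl (\<lambda>z. h (S z)) x))"
      using linf_lsl[OF S[OF g]] S_comult[OF bilin_mult[OF g h]]
      by (simp add: linf_rsl[OF g] mult.commute)
  qed
qed

section \<open>Finite-dimensional subcoalgebras\<close>

lemma lsl_in_span: "lsl h x \<in> span (snd ` set (\<Delta> x))"
proof -
  have "(\<Sum>(a,b)\<leftarrow>t. sc (h a) b) \<in> span (snd ` set t)" for t
  proof (induction t)
    case (Cons p t)
    have "span (snd ` set t) \<subseteq> span (snd ` set (p # t))" by (rule span_mono) auto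
    moreover have "snd p \<in> span (snd ` set (p # t))" by (rule span_base) simp
    ultimately show ?case
      using Cons by (simp add: case_prod_unfold span_add span_scale subset_iff del: set_simps)
  qed (simp add: span_zero)
  then show ?thesis by (simp add: lsl_def sw_def)
qed

lemma rsl_in_span: "rsl h x \<in> span (fst ` set (\<Delta> x))"
proof -
  have "(\<Sum>(a,b)\<leftarrow>t. sc (h b) a) \<in> span (fst ` set t)" for t
  proof (induction t)
    case (Cons p t)
    have "span (fst ` set t) \<subseteq> span (fst ` set (p # t))" by (rule span_mono) auto
    moreover have "fst p \<in> span (fst ` set (p # t))" by (rule span_base) simp
    ultimately show ?case
      using Cons by (simp add: case_prod_unfold span_add span_scale subset_iff del: set_simps)
  qed (simp add: span_zero)
  then show ?thesis by (simp add: rsl_def sw_def)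
qed

text \<open>The left slices of x form a finite-dimensional space. A dual basis e, f_e of it
  expresses the coproduct as the sum of the tensors of \<open>rsl f_e x\<close> and e, so every
  entry is an intrinsic slice of x.\<close>

lemma tens_slices:
  obtains u where "tens_eq sc (\<Delta> x) u"
    "set u \<subseteq> {rsl g x | g. linf g} \<times> {lsl h x | h. linf h}"
proof -
  let ?X = "{lsl h x | h. linf h}"
  have sub: "subspace ?X"
    unfolding subspace_def
  proof (intro conjI ballI allI)
    have "linf (\<lambda>z. 0)" by (simp add: lin_functional_iff)
    moreover have "lsl (\<lambda>z. 0) x = 0" using lsl_fun_scale[of 0] by simp
    ultimately show "0 \<in> ?X" by force
    fix u v assume "u \<in> ?X" "v \<in> ?X"
    then obtain h h' where "u = lsl h x" "v = lsl h' x" "linf h" "linf h'" by auto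
    then have "u + v = lsl (\<lambda>z. h z + h' z) x" "linf (\<lambda>z. h z + h' z)"
      by (auto simp: lsl_fun_add linf_simps)
    then show "u + v \<in> ?X" by blast
  next
    fix c u assume "u \<in> ?X"
    then obtain h where "u = lsl h x" "linf h" by auto
    then have "sc c u = lsl (\<lambda>z. c * h z) x" "linf (\<lambda>z. c * h z)"
      by (auto simp: lsl_fun_scale linf_simps)
    then show "sc c u \<in> ?X" by blast
  qed
  have "?X \<subseteq> span (snd ` set (\<Delta> x))" using lsl_in_span by auto
  moreover have "finite (snd ` set (\<Delta> x))" by simp
  ultimately obtain E f where E: "finite E" "E \<subseteq> ?X" "\<And>b. linf (f b)"
    "\<And>z. z \<in> ?X \<Longrightarrow> z = (\<Sum>b\<in>E. sc (f b z) b)"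
    by (rule dual_basis[OF sub]) (rule that)
  obtain es where es: "set es = E" "distinct es" using E(1) finite_distinct_list by blast
  show ?thesis
  proof
    show "set (map (\<lambda>e. (rsl (f e) x, e)) es) \<subseteq> {rsl g x | g. linf g} \<times> ?X"
      using E es by auto
    show "tens_eq sc (\<Delta> x) (map (\<lambda>e. (rsl (f e) x, e)) es)"
      unfolding tens_eq_def
    proof (intro allI impI)
      fix p q assume pq: "linf p \<and> linf q"
      have "(\<Sum>(a,b)\<leftarrow>\<Delta> x. p a * q b) = q (lsl p x)"
        using pq by (simp add: linf_lsl sw_def)
      also have "\<dots> = q (\<Sum>b\<in>E. sc (f b (lsl p x)) b)"
        by (intro arg_cong[where f = q] E(4)) (use pq in blast)
      also have "\<dots> = (\<Sum>b\<in>E. p (rsl (f b) x) * q b)"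
        using pq E(3) by (simp add: lin_functional_sum lin_functional_scale linf_lsl_swap)
      also have "\<dots> = (\<Sum>(a,b)\<leftarrow>map (\<lambda>e. (rsl (f e) x, e)) es. p a * q b)"
        using es by (simp add: o_def sum_list_distinct_conv_sum_set)
      finally show "(\<Sum>(a,b)\<leftarrow>\<Delta> x. p a * q b)
        = (\<Sum>(a,b)\<leftarrow>map (\<lambda>e. (rsl (f e) x, e)) es. p a * q b)" .
    qed
  qed
qed

text \<open>Trades the existence of a representative over C for closure under linear maps, which can
  be checked on generators. One direction slices the given representative; the other takes the one
  from \<open>tens_slices\<close>.\<close>

lemma in_tens2_iff:
  assumes C: "subspace C"
  shows "in_tens2 sc C (\<Delta> x) \<longleftrightarrow> (\<forall>h. linf h \<longrightarrow> lsl h x \<in> C \<and> rsl h x \<in> C)"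
proof
  assume "in_tens2 sc C (\<Delta> x)"
  then obtain u where u: "set u \<subseteq> C \<times> C" "tens_eq sc (\<Delta> x) u" by (auto simp: in_tens2_def)
  show "\<forall>h. linf h \<longrightarrow> lsl h x \<in> C \<and> rsl h x \<in> C"
  proof (intro allI impI)
    fix h assume h: "linf h"
    have "lsl h x = (\<Sum>(a,b)\<leftarrow>u. sc (h a) b)" unfolding lsl_def sw_def using u(2)
      by (rule tens_bilin_valued) (use h in \<open>simp add: bilin_def linf_simps lin_functional_scale\<close>)
    moreover have "rsl h x = (\<Sum>(a,b)\<leftarrow>u. sc (h b) a)" unfolding rsl_def sw_def using u(2)
      by (rule tens_bilin_valued) (use h in \<open>simp add: bilin_def linf_simps lin_functional_scale\<close>)
    moreover have "(\<Sum>(a,b)\<leftarrow>v. sc (h a) b) \<in> C \<and> (\<Sum>(a,b)\<leftarrow>v. sc (h b) a) \<in> C"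
      if "set v \<subseteq> C \<times> C" for v
      using that by (induction v) (auto simp: subspace_0[OF C] intro!: subspace_add[OF C] subspace_scale[OF C])
    ultimately show "lsl h x \<in> C \<and> rsl h x \<in> C" using u(1) by simp
  qed
next
  assume *: "\<forall>h. linf h \<longrightarrow> lsl h x \<in> C \<and> rsl h x \<in> C"
  obtain u where u: "tens_eq sc (\<Delta> x) u"
    "set u \<subseteq> {rsl g x | g. linf g} \<times> {lsl h x | h. linf h}" by (rule tens_slices)
  then have "set u \<subseteq> C \<times> C" using * by auto
  then show "in_tens2 sc C (\<Delta> x)" using u(1) by (auto simp: in_tens2_def)
qed

lemma subcoalgebra_iff:
  "subcoalgebra sc \<Delta> C \<longleftrightarrow>
     subspace C \<and> (\<forall>x\<in>C. \<forall>h. linf h \<longrightarrow> lsl h x \<in> C \<and> rsl h x \<in> C)"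
  unfolding subcoalgebra_def using in_tens2_iff by blast

lemma subcoalgebra_span:
  assumes "\<And>x h. x \<in> G \<Longrightarrow> linf h \<Longrightarrow> lsl h x \<in> span G" "\<And>x h. x \<in> G \<Longrightarrow> linf h \<Longrightarrow> rsl h x \<in> span G"
  shows "subcoalgebra sc \<Delta> (span G)"
  unfolding subcoalgebra_iff
proof (intro conjI ballI allI impI)
  fix x h assume x: "x \<in> span G" and h: "linf h"
  show "lsl h x \<in> span G" using x
    by (induction rule: span_induct_alt)
      (auto simp: lsl_0 lsl_add lsl_scale h assms intro!: span_add span_scale span_zero)
  show "rsl h x \<in> span G" using x
    by (induction rule: span_induct_alt)
      (auto simp: rsl_0 rsl_add rsl_scale h assms intro!: span_add span_scale span_zero)
qed simp

text \<open>The fundamental theorem of coalgebras. The two-sided slices of F include F (slice by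
  \<epsilon> twice), are stable under further slicing because slices compose by convolution, and lie
  in the span of finitely many list entries.\<close>

lemma finite_subcoalgebra:
  assumes F: "finite F"
  obtains C A where "subcoalgebra sc \<Delta> C" "F \<subseteq> C" "finite A" "C = span A"
proof -
  define G where "G = {rsl f (lsl h x) | f h x. linf f \<and> linf h \<and> x \<in> F}"
  define A where "A = (\<Union>x\<in>F. \<Union>y\<in>snd ` set (\<Delta> x). fst ` set (\<Delta> y))"
  have "subcoalgebra sc \<Delta> (span G)"
  proof (rule subcoalgebra_span)
    fix x h assume "x \<in> G" and h: "linf h"
    then obtain f h' y where x: "x = rsl f (lsl h' y)" "linf f" "linf h'" "y \<in> F"
      by (auto simp: G_def)
    have "lsl h x = rsl f (lsl (sw (\<lambda>a b. h' a * h b)) y)"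
      by (simp add: x rsl_lsl[symmetric] lsl_lsl h)
    then have "lsl h x \<in> G" using linf_conv[OF x(3) h] x by (auto simp: G_def)
    then show "lsl h x \<in> span G" by (rule span_base)
    have "rsl h x = rsl (sw (\<lambda>a b. h a * f b)) (lsl h' y)"
      by (simp add: x rsl_rsl h)
    then have "rsl h x \<in> G" using linf_conv[OF h x(2)] x by (auto simp: G_def)
    then show "rsl h x \<in> span G" by (rule span_base)
  qed
  moreover have "F \<subseteq> span G"
  proof
    fix x assume x: "x \<in> F"
    have "x = rsl \<epsilon> (lsl \<epsilon> x)" by (simp add: rsl_counit lsl_counit)
    then have "x \<in> G" using x linf_counit unfolding G_def by blast
    then show "x \<in> span G" by (rule span_base)
  qed
  moreover obtain A' where "finite A'" "span G = span A'"
  proof -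
    have "G \<subseteq> span A"
    proof
      fix z assume "z \<in> G"
      then obtain f h x where z: "z = rsl f (lsl h x)" and f: "linf f" and x: "x \<in> F"
        by (auto simp: G_def)
      have "rsl f y \<in> span A" if "y \<in> span (snd ` set (\<Delta> x))" for y using that
      proof (induction rule: span_induct_alt)
        case (step c b y)
        have "fst ` set (\<Delta> b) \<subseteq> A" using step(1) x by (auto simp: A_def)
        then have "rsl f b \<in> span A" using rsl_in_span[of f b] span_mono by blast
        then show ?case using step(2) by (auto simp: rsl_add rsl_scale f intro!: span_add span_scale)
      qed (simp add: rsl_0 f span_zero)
      then show "z \<in> span A" using z lsl_in_span by blast
    qed
    moreover have "finite A" using F by (auto simp: A_def)
    moreover obtain B where B: "B \<subseteq> G" "independent B" "G \<subseteq> span B"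
      using maximal_independent_subset by metis
    ultimately have "finite B" using independent_span_bound[of A B] by blast
    moreover have "span G = span B"
      using B by (meson span_eq span_superset subset_trans)
    ultimately show ?thesis using that by blast
  qed
  ultimately show ?thesis using that by blast
qed

section \<open>Hopf subalgebras and balanced forms\<close>

lemma subspace_sum_list:
  "subspace N \<Longrightarrow> (\<And>p. p \<in> set u \<Longrightarrow> f p \<in> N) \<Longrightarrow> sum_list (map f u) \<in> N"
  by (induction u) (auto simp: subspace_0 subspace_add)

text \<open>The representative u is arbitrary, so the factors b can be chosen inside a given Hopf
  subalgebra or among the slices of x.\<close>

lemma lsl_mult:
  assumes u: "tens_eq sc (\<Delta> x) u" and h: "linf h"
  shows "lsl h (x * y) = (\<Sum>(a,b)\<leftarrow>u. b * lsl (\<lambda>z. h (a * z)) y)"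
proof (rule eq_by_functionals)
  fix g assume g: "linf g"
  define \<Psi> where "\<Psi> a b = sw (\<lambda>c d. h (a * c) * g (b * d)) y" for a b
  have \<Psi>: "\<Psi> a b = g (b * lsl (\<lambda>z. h (a * z)) y)" for a b
    unfolding \<Psi>_def using linf_lsl[OF linf_comp(2)[OF g, of b]] by simp
  have "g (lsl h (x * y)) = sw \<Psi> x"
    unfolding linf_lsl[OF g] \<Psi>_def by (rule sw_mult[OF bilin_mult[OF h g]])
  also have "\<dots> = (\<Sum>(a,b)\<leftarrow>u. \<Psi> a b)"
    unfolding sw_def using u
    by (rule tens_bilin) (use g h in \<open>simp add: \<Psi>_def bilin_def linf_simps\<close>)
  finally show "g (lsl h (x * y)) = g (\<Sum>(a,b)\<leftarrow>u. b * lsl (\<lambda>z. h (a * z)) y)"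
    by (simp add: \<Psi> case_prod_unfold lin_functional_sum_list[OF g])
qed

lemma rsl_mult:
  assumes u: "tens_eq sc (\<Delta> x) u" and h: "linf h"
  shows "rsl h (x * y) = (\<Sum>(a,b)\<leftarrow>u. a * rsl (\<lambda>z. h (b * z)) y)"
proof (rule eq_by_functionals)
  fix g assume g: "linf g"
  define \<Psi> where "\<Psi> a b = sw (\<lambda>c d. g (a * c) * h (b * d)) y" for a b
  have \<Psi>: "\<Psi> a b = g (a * rsl (\<lambda>z. h (b * z)) y)" for a b
    unfolding \<Psi>_def using linf_rsl[OF linf_comp(2)[OF g, of a]] by simp
  have "g (rsl h (x * y)) = sw \<Psi> x"
    unfolding linf_rsl[OF g] \<Psi>_def by (rule sw_mult[OF bilin_mult[OF g h]])
  also have "\<dots> = (\<Sum>(a,b)\<leftarrow>u. \<Psi> a b)"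
    unfolding sw_def using u
    by (rule tens_bilin) (use g h in \<open>simp add: \<Psi>_def bilin_def linf_simps\<close>)
  finally show "g (rsl h (x * y)) = g (\<Sum>(a,b)\<leftarrow>u. a * rsl (\<lambda>z. h (b * z)) y)"
    by (simp add: \<Psi> case_prod_unfold lin_functional_sum_list[OF g])
qed

lemma lsl_1: "linf h \<Longrightarrow> lsl h 1 = sc (h 1) 1" and rsl_1: "linf h \<Longrightarrow> rsl h 1 = sc (h 1) 1"
proof -
  assume h: "linf h"
  show "lsl h 1 = sc (h 1) 1"
    by (rule eq_by_functionals) (simp add: linf_lsl sw_1[OF bilin_mult] h lin_functional_scale)
  show "rsl h 1 = sc (h 1) 1"
    by (rule eq_by_functionals) (simp add: linf_rsl sw_1[OF bilin_mult] h lin_functional_scale)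
qed

section \<open>Subalgebras closed under slices and the antipode\<close>

lemma subalgebraD:
  assumes "subalgebra sc A"
  shows "subspace A" "1 \<in> A" "x \<in> A \<Longrightarrow> y \<in> A \<Longrightarrow> x * y \<in> A"
  using assms by (auto simp: subalgebra_def)

lemma subalgebra_alg_gen: "subalgebra sc (alg_gen sc X)"
  and alg_gen_superset: "X \<subseteq> alg_gen sc X"
  and alg_gen_minimal: "subalgebra sc A \<Longrightarrow> X \<subseteq> A \<Longrightarrow> alg_gen sc X \<subseteq> A"
  by (auto simp: subalgebra_def alg_gen_def subspace_def)

lemma hopf_subalgebra_iff:
  "hopf_subalgebra sc \<Delta> S K \<longleftrightarrow> subalgebra sc K \<and>
     (\<forall>x\<in>K. \<forall>h. linf h \<longrightarrow> lsl h x \<in> K \<and> rsl h x \<in> K) \<and> S ` K \<subseteq> K"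
  unfolding hopf_subalgebra_def using in_tens2_iff subalgebraD(1) by blast

lemma hopf_subalgebra_tens:
  assumes "hopf_subalgebra sc \<Delta> S K" "x \<in> K"
  obtains u where "tens_eq sc (\<Delta> x) u" "set u \<subseteq> K \<times> K"
  using assms by (auto simp: hopf_subalgebra_def in_tens2_def)

lemma subalgebra_S_closed:
  assumes "subalgebra sc A"
  shows "subalgebra sc {x \<in> A. S x \<in> A}"
proof -
  have "S 0 = 0" using S_scale[of 0 0] by simp
  then show ?thesis
    using assms unfolding subalgebra_def subspace_def by (simp add: S_add S_scale S_mult S_1)
qed

lemma subalgebra_slices_closed:
  assumes A: "subalgebra sc A"
  shows "subalgebra sc {x \<in> A. \<forall>h. linf h \<longrightarrow> lsl h x \<in> A \<and> rsl h x \<in> A}" (is "subalgebra sc ?T")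
proof -
  note AA = subalgebraD[OF A]
  have "x * y \<in> ?T" if xy: "x \<in> ?T" "y \<in> ?T" for x y
  proof -
    obtain u where u: "tens_eq sc (\<Delta> x) u"
      "set u \<subseteq> {rsl g x | g. linf g} \<times> {lsl h x | h. linf h}" by (rule tens_slices)
    have uA: "set u \<subseteq> A \<times> A" using u(2) xy(1) by auto
    have "lsl h (x * y) \<in> A \<and> rsl h (x * y) \<in> A" if h: "linf h" for h
      unfolding lsl_mult[OF u(1) h] rsl_mult[OF u(1) h] using uA xy(2) linf_comp(2)[OF h]
      by (auto intro!: subspace_sum_list AA)
    then show ?thesis using xy AA(3) by blast
  qed
  moreover have "subspace ?T"
    using AA(1) unfolding subspace_def
    by (auto simp: lsl_add rsl_add lsl_scale rsl_scale lsl_0 rsl_0)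
  moreover have "1 \<in> ?T" using AA by (auto simp: lsl_1 rsl_1 subspace_scale)
  ultimately show ?thesis unfolding subalgebra_def by blast
qed

text \<open>Having S-image in K and having all slices in K are conditions that cut out subalgebras
  of K, so they are tested on the generators. There S moves S^i(C) to S^(i+1)(C), and slicing
  preserves each S^i(C) because S exchanges left and right slices.\<close>

lemma hopf_subalgebra_generated:
  assumes C: "subcoalgebra sc \<Delta> C"
  shows "hopf_subalgebra sc \<Delta> S (alg_gen sc (\<Union>i. (S ^^ i) ` C))"
proof -
  define X where "X = (\<Union>i. (S ^^ i) ` C)"
  define K where "K = alg_gen sc X"
  have K: "subalgebra sc K" unfolding K_def by (rule subalgebra_alg_gen)
  have XK: "X \<subseteq> K" unfolding K_def by (rule alg_gen_superset)
  have "S x \<in> X" if "x \<in> X" for x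
  proof -
    from that obtain i y where "x = (S ^^ i) y" "y \<in> C" by (auto simp: X_def)
    then have "S x \<in> (S ^^ Suc i) ` C" by simp
    then show ?thesis unfolding X_def by blast
  qed
  then have "X \<subseteq> {x \<in> K. S x \<in> K}" using XK by (simp add: subset_iff)
  then have S: "S ` K \<subseteq> K"
    using alg_gen_minimal[OF subalgebra_S_closed[OF K]] by (auto simp: K_def)
  have pow: "linf h \<Longrightarrow> x \<in> (S ^^ i) ` C \<Longrightarrow> lsl h x \<in> (S ^^ i) ` C \<and> rsl h x \<in> (S ^^ i) ` C" for h x i
  proof (induction i arbitrary: x h)
    case 0
    then show ?case using C by (auto simp: subcoalgebra_iff)
  next
    case (Suc i)
    then obtain y where y: "x = S y" "y \<in> (S ^^ i) ` C" by auto
    have "linf (\<lambda>z. h (S z))" using Suc.prems(1) by (rule linf_comp)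
    from Suc.IH[OF this y(2)] show ?case
      using Suc.prems(1) by (auto simp: y(1) lsl_S rsl_S)
  qed
  have "lsl h x \<in> X \<and> rsl h x \<in> X" if "linf h" "x \<in> X" for h x
  proof -
    from that(2) obtain i where "x \<in> (S ^^ i) ` C" by (auto simp: X_def)
    moreover have "(S ^^ i) ` C \<subseteq> X" unfolding X_def by auto
    ultimately show ?thesis using pow[OF that(1)] by (simp add: subset_iff)
  qed
  then have "X \<subseteq> {x \<in> K. \<forall>h. linf h \<longrightarrow> lsl h x \<in> K \<and> rsl h x \<in> K}"
    using XK by (simp add: subset_iff)
  then have "\<forall>x\<in>K. \<forall>h. linf h \<longrightarrow> lsl h x \<in> K \<and> rsl h x \<in> K"
    using alg_gen_minimal[OF subalgebra_slices_closed[OF K]] by (auto simp: K_def)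
  then show ?thesis using K S unfolding hopf_subalgebra_iff K_def X_def by simp
qed

text \<open>If the augmentation ideal of H is generated by elements of K, then the inclusion of K
  in H is a ring epimorphism, expressed by balanced bilinear forms: the map sending h to the
  tensor of \<open>h\<^sub>1\<close> and \<open>S h\<^sub>2\<close> over K is trivial on the augmentation ideal.\<close>

lemma balanced_form_symmetric:
  assumes K: "hopf_subalgebra sc \<Delta> S K" and F: "F \<subseteq> K" "\<And>x. x \<in> F \<Longrightarrow> \<epsilon> x = 0"
    and gen: "\<And>I. left_ideal I \<Longrightarrow> F \<subseteq> I \<Longrightarrow> {x. \<epsilon> x = 0} \<subseteq> I"
    and \<beta>: "bilin \<beta>" and bal: "\<And>x k y. k \<in> K \<Longrightarrow> \<beta> (x * k) y = \<beta> x (k * y)"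
  shows "\<beta> h 1 = \<beta> 1 h"
proof -
  have \<beta>': "linf (\<beta> a)" "linf (\<lambda>a. \<beta> a b)" for a b using \<beta> by (auto simp: bilin_def)
  \<comment> \<open>In legs, \<open>\<tau> n x\<close> is \<beta>(x1, S(x2) n). The parameter n
    receives the third leg when \<beta>(h1, S(h2) h3) is regrouped at the end.\<close>
  define \<tau> where "\<tau> n = sw (\<lambda>a b. \<beta> a (S b * n))" for n
  have B: "bilin (\<lambda>a b. \<beta> a (S b * n))" for n
    using \<beta>' by (simp add: bilin_def linf_simps)
  have \<tau>: "linf (\<tau> n)" for n unfolding \<tau>_def by (rule linf_sw[OF B])
  \<comment> \<open>Since S(x2 k2) = S(k2) S(x2), balancedness carries k1 across \<beta> until it
    meets S(k2). For this the coproduct of k must be represented by entries in K.\<close>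
  have \<tau>K: "\<tau> n (x * k) = \<epsilon> k * \<tau> n x" if k: "k \<in> K" for n x k
  proof -
    obtain u where u: "tens_eq sc (\<Delta> k) u" "set u \<subseteq> K \<times> K"
      using hopf_subalgebra_tens[OF K k] .
    have "sw (\<lambda>c d. \<beta> (a * c) (S (b * d) * n)) k = \<epsilon> k * \<beta> a (S b * n)" for a b
    proof -
      have "sw (\<lambda>c d. \<beta> (a * c) (S (b * d) * n)) k = (\<Sum>(c,d)\<leftarrow>u. \<beta> (a * c) (S (b * d) * n))"
        unfolding sw_def using u(1)
        by (rule tens_bilin) (use \<beta>' in \<open>simp add: bilin_def linf_simps\<close>)
      also have "\<dots> = (\<Sum>(c,d)\<leftarrow>u. \<beta> a (1 * c * S d * (S b * n)))"
        using u(2) by (intro arg_cong[where f = sum_list] map_cong refl)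
          (auto simp: bal S_mult mult.assoc)
      also have "\<dots> = sw (\<lambda>c d. \<beta> a (1 * c * S d * (S b * n))) k"
        unfolding sw_def using u(1)
        by (rule tens_bilin[symmetric]) (use \<beta>' in \<open>simp add: bilin_def linf_simps\<close>)
      also have "\<dots> = \<epsilon> k * \<beta> a (S b * n)"
        using sw_antipode_linf(2)[OF \<beta>'(1), of a 1 "S b * n" k] by simp
      finally show ?thesis .
    qed
    then show ?thesis unfolding \<tau>_def sw_mult[OF B] by (simp add: sw_cmult)
  qed
  have \<tau>0: "\<tau> n y = 0" if "\<epsilon> y = 0" for n y
  proof -
    \<comment> \<open>Quantifying over x makes the set stable under left multiplication; x = 1
      recovers the vanishing of \<open>\<tau> n y\<close>.\<close>
    let ?I = "{y. \<forall>x. \<tau> n (x * y) = 0}"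
    have "left_ideal ?I"
      by (auto simp: left_ideal_def distrib_left lin_functional_add[OF \<tau>] lin_functional_0[OF \<tau>]
          simp flip: mult.assoc)
    moreover have "F \<subseteq> ?I" using F \<tau>K by auto
    ultimately have "y \<in> ?I" using gen that by blast
    then have "\<tau> n (1 * y) = 0" by blast
    then show ?thesis by simp
  qed
  have \<tau>\<epsilon>: "\<tau> n x = \<epsilon> x * \<beta> 1 n" for n x
  proof -
    have "\<epsilon> (x - sc (\<epsilon> x) 1) = 0"
      by (simp add: lin_functional_diff[OF linf_counit] lin_functional_scale[OF linf_counit] counit_1)
    from \<tau>0[OF this] have "\<tau> n x = \<epsilon> x * \<tau> n 1"
      by (simp add: lin_functional_diff[OF \<tau>] lin_functional_scale[OF \<tau>])
    also have "\<tau> n 1 = \<beta> 1 n" unfolding \<tau>_def sw_1[OF B] by (simp add: S_1)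
    finally show ?thesis .
  qed
  have "\<beta> h 1 = sw (\<lambda>a b. \<epsilon> b * \<beta> a 1) h"
    by (rule sw_counit_right[symmetric, OF \<beta>'(2)])
  also have "\<dots> = sw (\<lambda>a b. sw (\<lambda>c d. \<beta> a (S c * d)) b) h"
    using sw_antipode_linf(1)[OF \<beta>'(1), of _ 1 1] by simp
  also have "\<dots> = sw (\<lambda>a b. sw (\<lambda>c d. \<beta> c (S d * b)) a) h"
    by (rule sw_coassoc[symmetric]) (use \<beta>' in \<open>simp add: trilin_def bilin_def linf_simps\<close>)
  also have "\<dots> = sw (\<lambda>a b. \<epsilon> a * \<beta> 1 b) h" using \<tau>\<epsilon> by (simp add: \<tau>_def)
  also have "\<dots> = \<beta> 1 h" by (rule sw_counit_left[OF \<beta>'(1)])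
  finally show ?thesis .
qed

text \<open>Otherwise one could keep choosing an element of the augmentation ideal outside the left
  ideal generated so far, against the ascending chain condition.\<close>

lemma augmentation_finitely_generated:
  assumes noeth: "left_noetherian TYPE('h)"
  obtains F where "finite F" "\<And>x. x \<in> F \<Longrightarrow> \<epsilon> x = 0"
    "\<And>I. left_ideal I \<Longrightarrow> F \<subseteq> I \<Longrightarrow> {x. \<epsilon> x = 0} \<subseteq> I"
proof (rule ccontr)
  note conclude = that
  assume neg: "\<not> thesis"
  define lid where "lid F = \<Inter>{I. left_ideal I \<and> F \<subseteq> I}" for F :: "'h set"
  have lid: "left_ideal (lid F)" "F \<subseteq> lid F" for F by (auto simp: lid_def left_ideal_def)
  have mono: "F \<subseteq> G \<Longrightarrow> lid F \<subseteq> lid G" for F G by (auto simp: lid_def)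
  have "\<exists>x. \<epsilon> x = 0 \<and> x \<notin> lid F" if F: "finite F" "\<forall>x\<in>F. \<epsilon> x = 0" for F
  proof (rule ccontr)
    assume "\<nexists>x. \<epsilon> x = 0 \<and> x \<notin> lid F"
    then have "{x. \<epsilon> x = 0} \<subseteq> I" if "left_ideal I" "F \<subseteq> I" for I
      using that by (auto simp: lid_def)
    then show False using conclude[OF F(1)] F(2) neg by blast
  qed
  then obtain g where g: "\<And>F. finite F \<Longrightarrow> \<forall>x\<in>F. \<epsilon> x = 0 \<Longrightarrow> \<epsilon> (g F) = 0 \<and> g F \<notin> lid F" by metis
  define Fs where "Fs = rec_nat {} (\<lambda>_ F. insert (g F) F)"
  have Fs: "Fs 0 = {}" "Fs (Suc n) = insert (g (Fs n)) (Fs n)" for n by (simp_all add: Fs_def)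
  have ok: "finite (Fs n) \<and> (\<forall>x\<in>Fs n. \<epsilon> x = 0)" for n
  proof (induction n)
    case (Suc n)
    then show ?case using g[of "Fs n"] by (simp add: Fs)
  qed (simp add: Fs)
  have "lid (Fs n) \<subseteq> lid (Fs (Suc n))" for n
    unfolding Fs by (intro mono subset_insertI)
  then have "\<exists>N. \<forall>n\<ge>N. lid (Fs n) = lid (Fs N)"
    using lid(1) by (intro noeth[unfolded left_noetherian_def, rule_format]) simp
  then obtain N where N: "\<forall>n\<ge>N. lid (Fs n) = lid (Fs N)" ..
  have "lid (Fs (Suc N)) = lid (Fs N)" by (rule N[rule_format]) simp
  moreover have "g (Fs N) \<in> lid (Fs (Suc N))" using lid(2)[of "Fs (Suc N)"] by (simp add: Fs)
  ultimately show False using g[of "Fs N"] ok[of N] by simp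
qed

end

section \<open>Faithfully flat Hopf subalgebras\<close>

definition fun_scale :: "('k \<Rightarrow> 'h \<Rightarrow> 'h) \<Rightarrow> 'k \<Rightarrow> ('h \<Rightarrow> 'h) \<Rightarrow> 'h \<Rightarrow> 'h" where
  "fun_scale sc c f = (\<lambda>n. sc c (f n))"

text \<open>Relations of the module \<open>H/K\<close>: the coefficient functions, supported in Y, whose linear
  combination of the tautological generators lies in K.\<close>

definition relations :: "'h::ring_1 set \<Rightarrow> 'h set \<Rightarrow> ('h \<Rightarrow> 'h) set" where
  "relations K Y = {a. (\<forall>n. a n \<in> K) \<and> (\<forall>n. n \<notin> Y \<longrightarrow> a n = 0) \<and> (\<Sum>n\<in>Y. a n * n) \<in> K}"

text \<open>H/K is presented as the free left K-module on the elements of H modulo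
  \<open>relations\<close>. Tensoring with H over K is right exact, so the H-multiples of relations
  span the kernel of the presented tensor product.\<close>

definition rel_gens :: "'h::ring_1 set \<Rightarrow> ('h \<Rightarrow> 'h) set" where
  "rel_gens K = {\<lambda>n. y * a n | y a Y. finite Y \<and> a \<in> relations K Y}"

context hopf
begin

lemma vector_space_fun: "vector_space (fun_scale sc)"
  by unfold_locales
    (auto simp: fun_scale_def fun_eq_iff scale_right_distrib scale_left_distrib)

lemma subalgebra_sum:
  assumes "subalgebra sc K" "\<And>i. i \<in> I \<Longrightarrow> f i \<in> K"
  shows "sum f I \<in> K"
  using subspace_sum[OF subalgebraD(1)[OF assms(1)], of I f] assms(2) by blast

lemma relations_mono:
  assumes "Y \<subseteq> Y'" "finite Y'" "a \<in> relations K Y"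
  shows "a \<in> relations K Y'"
proof -
  have "(\<Sum>n\<in>Y. a n * n) = (\<Sum>n\<in>Y'. a n * n)"
    using assms by (intro sum.mono_neutral_left) (auto simp: relations_def)
  then show ?thesis using assms unfolding relations_def by auto
qed

lemma relations_combine:
  assumes K: "subalgebra sc K" and a: "\<And>j. j < p \<Longrightarrow> a j \<in> relations K Y" and b: "\<And>j. j < p \<Longrightarrow> b j \<in> K"
  shows "(\<lambda>m. \<Sum>j<p. b j * a j m) \<in> relations K Y"
proof -
  have "(\<Sum>m\<in>Y. (\<Sum>j<p. b j * a j m) * m) = (\<Sum>j<p. b j * (\<Sum>m\<in>Y. a j m * m))"
    by (simp add: sum_distrib_left sum_distrib_right mult.assoc) (rule sum.swap)
  also have "\<dots> \<in> K"
    by (rule subalgebra_sum[OF K], rule subalgebraD(3)[OF K])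
      (use a b in \<open>auto simp: relations_def\<close>)
  finally have 1: "(\<Sum>m\<in>Y. (\<Sum>j<p. b j * a j m) * m) \<in> K" .
  have 2: "(\<Sum>j<p. b j * a j m) \<in> K" for m
    using a b by (intro subalgebra_sum[OF K] subalgebraD(3)[OF K]) (auto simp: relations_def)
  have 3: "(\<Sum>j<p. b j * a j m) = 0" if "m \<notin> Y" for m
    using a that by (intro sum.neutral) (auto simp: relations_def)
  show ?thesis unfolding relations_def using 1 2 3 by blast
qed

lemma rel_span_representation:
  assumes K: "subalgebra sc K" and f: "f \<in> module.span (fun_scale sc) (rel_gens K)"
  shows "\<exists>Y p y a. finite Y \<and> (\<forall>j<p::nat. a j \<in> relations K Y) \<and> (\<forall>n. f n = (\<Sum>j<p. y j * a j n))"
proof -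
  interpret V: vector_space "fun_scale sc" by (rule vector_space_fun)
  show ?thesis using f
  proof (induction rule: V.span_induct_alt)
    case base
    show ?case by (intro exI[of _ "{}"] exI[of _ "0::nat"]) simp
  next
    case (step c g f)
    obtain y' a' Y' where g: "g = (\<lambda>n. y' * a' n)" "finite Y'" "a' \<in> relations K Y'"
      using step(1) by (auto simp: rel_gens_def)
    obtain Y p y a where IH: "finite Y" "\<forall>j<p::nat. a j \<in> relations K Y" "\<forall>n. f n = (\<Sum>j<p. y j * a j n)"
      using step(2) by blast
    let ?y = "\<lambda>j. if j = p then sc c y' else y j" and ?a = "\<lambda>j. if j = p then a' else a j"
    have "\<forall>j<Suc p. ?a j \<in> relations K (Y \<union> Y')"
      using IH g relations_mono[of Y "Y \<union> Y'"] relations_mono[of Y' "Y \<union> Y'"]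
      by (auto simp: less_Suc_eq)
    moreover have "\<forall>n. (fun_scale sc c g + f) n = (\<Sum>j<Suc p. ?y j * ?a j n)"
      using IH(3) by (simp add: fun_scale_def g(1))
    moreover have "finite (Y \<union> Y')" using IH g by simp
    ultimately show ?case
      by (intro exI[of _ "Y \<union> Y'"] exI[of _ "Suc p"] exI[of _ ?y] exI[of _ ?a] conjI)
  qed
qed

text \<open>The equational criterion, applied to the n-th coordinates of the relations, makes one
  more coordinate vanish. Coordinates cleared earlier stay zero because the new relations are
  K-combinations of the old ones.\<close>

lemma flat_representation:
  assumes K: "subalgebra sc K" and flat: "right_flat_over K" and X: "finite X"
    and rep: "\<forall>j<p::nat. a j \<in> relations K Y" "\<forall>n. f n = (\<Sum>j<p. y j * a j n)"
    and f: "\<And>n. n \<in> X \<Longrightarrow> f n = 0"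
  shows "\<exists>p y a. (\<forall>j<p::nat. a j \<in> relations K Y \<and> (\<forall>n\<in>X. a j n = 0)) \<and>
      (\<forall>n. f n = (\<Sum>j<p. y j * a j n))"
  using X f
proof (induction X rule: finite_induct)
  case empty
  then show ?case using rep by auto
next
  case (insert n X)
  then obtain p y a where IH: "\<forall>j<p::nat. a j \<in> relations K Y \<and> (\<forall>n\<in>X. a j n = 0)"
    "\<forall>n. f n = (\<Sum>j<p. y j * a j n)" by auto
  have "(\<forall>i<p. a i n \<in> K) \<and> (\<Sum>i<p. y i * a i n) = 0"
    using IH insert.prems[of n] by (auto simp: relations_def)
  from flat[unfolded right_flat_over_def, rule_format, OF this]
  obtain q :: nat and z b where "(\<forall>j<q. \<forall>i<p. b j i \<in> K) \<and> (\<forall>i<p. y i = (\<Sum>j<q. z j * b j i)) \<and>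
      (\<forall>j<q. (\<Sum>i<p. b j i * a i n) = 0)"
    by (elim exE) (rule that)
  then have b: "\<forall>j<q. \<forall>i<p. b j i \<in> K" "\<forall>i<p. y i = (\<Sum>j<q. z j * b j i)"
    "\<forall>j<q. (\<Sum>i<p. b j i * a i n) = 0" by simp_all
  let ?a = "\<lambda>j m. \<Sum>i<p. b j i * a i m"
  have "\<forall>j<q. ?a j \<in> relations K Y \<and> (\<forall>n\<in>insert n X. ?a j n = 0)"
    using IH(1) b(1,3) by (auto intro!: relations_combine[OF K] sum.neutral)
  moreover have "f m = (\<Sum>j<q. z j * ?a j m)" for m
  proof -
    have "f m = (\<Sum>i<p. (\<Sum>j<q. z j * b j i) * a i m)"
      using IH(2) b(2) by simp
    also have "\<dots> = (\<Sum>j<q. z j * ?a j m)"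
      by (simp add: sum_distrib_left sum_distrib_right mult.assoc) (rule sum.swap)
    finally show ?thesis .
  qed
  ultimately show ?case
    by (intro exI[of _ q] exI[of _ z] exI[of _ ?a] conjI) auto
qed

text \<open>The functions \<open>H \<rightarrow> H\<close> of finite support modulo the span of \<open>rel_gens K\<close> form the tensor product
  of H and \<open>H/K\<close> over K; faithful flatness says that the tensor of 1 and the class of h does not vanish.\<close>

lemma faithfully_flat_not_in_rel_span:
  assumes K: "subalgebra sc K" and ff: "right_faithfully_flat_over K" and h: "h \<notin> K"
  shows "(\<lambda>n. if n = h then 1 else 0) \<notin> module.span (fun_scale sc) (rel_gens K)"
    (is "?e \<notin> _")
proof
  assume "?e \<in> module.span (fun_scale sc) (rel_gens K)"
  from rel_span_representation[OF K this] obtain Y p y a where Y: "finite Y"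
    "\<forall>j<p::nat. a j \<in> relations K Y" "\<forall>n. ?e n = (\<Sum>j<p. y j * a j n)" by blast
  note KK = subalgebraD[OF K]
  have flat: "right_flat_over K" using ff by (simp add: right_faithfully_flat_over_def)
  \<comment> \<open>After all coordinates other than h are cleared, each relation concerns the
    single class of h.\<close>
  have "finite (Y - {h})" using Y(1) by simp
  from flat_representation[OF K flat this Y(2,3)] obtain p y a where
    a: "\<forall>j<p::nat. a j \<in> relations K Y \<and> (\<forall>n\<in>Y - {h}. a j n = 0)"
    "\<forall>n. ?e n = (\<Sum>j<p. y j * a j n)" by auto
  \<comment> \<open>The annihilator of the class of h in H/K, a proper left ideal as h is not in K.
    The cleared relations have their h-coordinates in I and combine to 1, so H I = H, contrary to
    faithful flatness.\<close>
  define I where "I = {k \<in> K. k * h \<in> K}"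
  have "left_ideal_of K I"
    unfolding left_ideal_of_def I_def
    by (simp add: distrib_right mult.assoc KK(3) subspace_add[OF KK(1)] subspace_0[OF KK(1)])
  moreover have "1 \<notin> I" using h by (simp add: I_def)
  then have "I \<noteq> K" using KK(2) by blast
  ultimately have neq: "{\<Sum>i<n. m i * r i | (n::nat) m r. \<forall>i<n. r i \<in> I} \<noteq> (UNIV :: 'h set)"
    by (intro ff[unfolded right_faithfully_flat_over_def, THEN conjunct2, rule_format] conjI)
  have aI: "a j h \<in> I" if j: "j < p" for j
  proof -
    have aj: "a j \<in> relations K Y" "\<forall>n\<in>Y - {h}. a j n = 0" using a(1) j by auto
    have "a j h * h = (\<Sum>n\<in>Y. a j n * n)"
    proof (cases "h \<in> Y")
      case True
      then show ?thesis using aj(2) sum.remove[OF Y(1) True, of "\<lambda>n. a j n * n"] by simp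
    next
      case False
      then have "a j h = 0" "\<forall>n\<in>Y. a j n = 0" using aj by (auto simp: relations_def)
      then show ?thesis by simp
    qed
    then show ?thesis using aj(1) by (auto simp: I_def relations_def)
  qed
  have "x \<in> {\<Sum>i<n. m i * r i | (n::nat) m r. \<forall>i<n. r i \<in> I}" for x
  proof -
    have "(\<Sum>j<p. y j * a j h) = 1" using a(2)[rule_format, of h] by simp
    then have "x = (\<Sum>j<p. x * y j * a j h)"
      by (simp add: mult.assoc flip: sum_distrib_left)
    then show ?thesis using aI
      by (intro CollectI exI[of _ p] exI[of _ "\<lambda>j. x * y j"] exI[of _ "\<lambda>j. a j h"]) simp
  qed
  then show False using neq by blast
qed

text \<open>\<beta>(x, n) is \<phi> at the tensor of x with the class of n, where \<phi> is a
  functional on the tensor product of H and H/K over K that does not vanish at the tensor of 1 with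
  the class of h.\<close>

lemma faithfully_flat_form:
  assumes K: "subalgebra sc K" and ff: "right_faithfully_flat_over K" and h: "h \<notin> K"
  obtains \<beta> where "bilin \<beta>" "\<And>x k y. k \<in> K \<Longrightarrow> \<beta> (x * k) y = \<beta> x (k * y)"
    "\<And>x n. n \<in> K \<Longrightarrow> \<beta> x n = 0" "\<beta> 1 h = 1"
proof -
  interpret V: vector_space "fun_scale sc" by (rule vector_space_fun)
  note KK = subalgebraD[OF K]
  obtain \<phi> where \<phi>: "lin_functional (fun_scale sc) \<phi>" "\<And>z. z \<in> V.span (rel_gens K) \<Longrightarrow> \<phi> z = 0"
    "\<phi> (\<lambda>n. if n = h then 1 else 0) = 1"
    using V.separating_functional[OF V.subspace_span faithfully_flat_not_in_rel_span[OF assms]] by metis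
  define \<beta> where "\<beta> x n = \<phi> (\<lambda>m. if m = n then x else 0)" for x n
  have add: "\<beta> (x + y) n = \<beta> x n + \<beta> y n" for x y n
  proof -
    have "(\<lambda>m. if m = n then x + y else 0) = (\<lambda>m. if m = n then x else 0) + (\<lambda>m. if m = n then y else 0)"
      by (auto simp: fun_eq_iff)
    then show ?thesis unfolding \<beta>_def by (simp only: V.lin_functional_add[OF \<phi>(1)])
  qed
  have scale: "\<beta> (sc c x) n = c * \<beta> x n" for c x n
  proof -
    have "(\<lambda>m. if m = n then sc c x else 0) = fun_scale sc c (\<lambda>m. if m = n then x else 0)"
      by (auto simp: fun_eq_iff fun_scale_def)
    then show ?thesis unfolding \<beta>_def by (simp only: V.lin_functional_scale[OF \<phi>(1)])
  qed
  have lin: "linf (\<lambda>x. \<beta> x n)" for n by (simp add: lin_functional_iff add scale)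
  \<comment> \<open>Relations with three terms are enough for additivity, homogeneity and
    balancedness. The points n1, n2, n3 may coincide, so \<open>a\<close> is a sum of point masses
    instead of a definition by cases.\<close>
  have rel: "\<beta> (x * k1) n1 + \<beta> (x * k2) n2 + \<beta> (x * k3) n3 = 0"
    if k: "k1 \<in> K" "k2 \<in> K" "k3 \<in> K" "k1 * n1 + k2 * n2 + k3 * n3 \<in> K" for x k1 n1 k2 n2 k3 n3
  proof -
    define \<delta> where "\<delta> n k = (\<lambda>m. if m = n then k else 0)" for n k :: 'h
    define a where "a m = \<delta> n1 k1 m + \<delta> n2 k2 m + \<delta> n3 k3 m" for m
    have "(\<Sum>m\<in>{n1,n2,n3}. \<delta> n k m * m) = k * n" if "n \<in> {n1,n2,n3}" for n k
    proof -
      have "(\<Sum>m\<in>{n1,n2,n3}. \<delta> n k m * m) = (\<Sum>m\<in>{n1,n2,n3}. if m = n then k * n else 0)"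
        by (intro sum.cong) (auto simp: \<delta>_def)
      also have "\<dots> = k * n" using that by (subst sum.delta) auto
      finally show ?thesis .
    qed
    then have "(\<Sum>m\<in>{n1,n2,n3}. a m * m) = k1 * n1 + k2 * n2 + k3 * n3"
      unfolding a_def distrib_right sum.distrib by simp
    moreover have "a m \<in> K" for m
      unfolding a_def \<delta>_def using k KK(1) by (intro subspace_add) (auto simp: subspace_0)
    ultimately have "a \<in> relations K {n1,n2,n3}"
      using k(4) by (auto simp: relations_def a_def \<delta>_def)
    then have "(\<lambda>m. x * a m) \<in> rel_gens K" unfolding rel_gens_def
      by (intro CollectI exI[of _ x] exI[of _ a] exI[of _ "{n1,n2,n3}"]) simp
    then have "\<phi> (\<lambda>m. x * a m) = 0" by (intro \<phi>(2) V.span_base)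
    moreover have "(\<lambda>m. x * a m) = \<delta> n1 (x * k1) + \<delta> n2 (x * k2) + \<delta> n3 (x * k3)"
      by (auto simp: fun_eq_iff a_def \<delta>_def distrib_left)
    ultimately show ?thesis
      unfolding \<beta>_def by (simp add: V.lin_functional_add[OF \<phi>(1)] \<delta>_def)
  qed
  have K0: "0 \<in> K" "1 \<in> K" "- 1 \<in> K" using KK by (auto simp: subspace_0 subspace_neg)
  have neg: "\<beta> (- x) n = - \<beta> x n" for x n using lin_functional_minus[OF lin] .
  have zero: "\<beta> 0 n = 0" for n using lin_functional_0[OF lin] .
  have "\<beta> x (n + n') = \<beta> x n + \<beta> x n'" for x n n'
    using rel[of 1 "- 1" "- 1" "n + n'" n n' x] K0 by (simp add: neg diff_eq_eq add.commute)
  moreover have "\<beta> x (sc c n) = c * \<beta> x n" for x c n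
  proof -
    have "sc c 1 \<in> K" using KK by (simp add: subspace_scale)
    then show ?thesis
      using rel[of "sc c 1" "- 1" 0 n "sc c n" 0 x] K0 by (simp add: neg zero scale)
  qed
  ultimately have "linf (\<beta> x)" for x by (simp add: lin_functional_iff)
  then have "bilin \<beta>" using lin by (simp add: bilin_def)
  moreover have "\<beta> (x * k) y = \<beta> x (k * y)" if "k \<in> K" for x k y
    using rel[of k "- 1" 0 y "k * y" 0 x] K0 that by (simp add: neg zero)
  moreover have "\<beta> x n = 0" if "n \<in> K" for x n
    using rel[of 1 0 0 n 0 0 x] K0 that by (simp add: zero)
  moreover have "\<beta> 1 h = 1" using \<phi>(3) by (simp add: \<beta>_def)
  ultimately show ?thesis using that by blast
qed

text \<open>For h outside K the form vanishes at (h, 1), since 1 lies in K, but not at (1, h); this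
  contradicts its symmetry.\<close>

lemma faithfully_flat_eq_UNIV:
  assumes K: "hopf_subalgebra sc \<Delta> S K" and F: "F \<subseteq> K" "\<And>x. x \<in> F \<Longrightarrow> \<epsilon> x = 0"
    and gen: "\<And>I. left_ideal I \<Longrightarrow> F \<subseteq> I \<Longrightarrow> {x. \<epsilon> x = 0} \<subseteq> I"
    and ff: "right_faithfully_flat_over K"
  shows "K = UNIV"
proof (rule ccontr)
  assume "K \<noteq> UNIV"
  then obtain h where h: "h \<notin> K" by blast
  have sub: "subalgebra sc K" using K by (simp add: hopf_subalgebra_def)
  obtain \<beta> where \<beta>: "bilin \<beta>" "\<And>x k y. k \<in> K \<Longrightarrow> \<beta> (x * k) y = \<beta> x (k * y)"
    "\<And>x n. n \<in> K \<Longrightarrow> \<beta> x n = 0" "\<beta> 1 h = 1"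
    by (rule faithfully_flat_form[OF sub ff h]) (rule that)
  have "\<beta> h 1 = \<beta> 1 h"
    using K F gen \<beta>(1,2) by (rule balanced_form_symmetric[where \<beta> = \<beta> and h = h and F = F])
  then show False using \<beta>(3,4) subalgebraD(2)[OF sub] by simp
qed

section \<open>Pointed Hopf algebras\<close>

text \<open>A tensor is determined by its left slices, so the second condition says that the
  coproduct of g is the tensor of g with itself.\<close>

definition grouplike :: "'h \<Rightarrow> bool" where
  "grouplike g \<longleftrightarrow> \<epsilon> g = 1 \<and> (\<forall>h. linf h \<longrightarrow> lsl h g = sc (h g) g)"

definition left_coideal :: "'h set \<Rightarrow> bool" where
  "left_coideal N \<longleftrightarrow> subspace N \<and> (\<forall>x\<in>N. \<forall>h. linf h \<longrightarrow> lsl h x \<in> N)"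

lemma left_coidealD:
  assumes "left_coideal N"
  shows "subspace N" "x \<in> N \<Longrightarrow> linf h \<Longrightarrow> lsl h x \<in> N"
  using assms by (auto simp: left_coideal_def)

lemma grouplikeD: "grouplike g \<Longrightarrow> \<epsilon> g = 1" "grouplike g \<Longrightarrow> linf h \<Longrightarrow> lsl h g = sc (h g) g"
  by (auto simp: grouplike_def)

lemma grouplike_tens:
  assumes g: "grouplike g"
  shows "tens_eq sc (\<Delta> g) [(g, g)]"
  unfolding tens_eq_def
proof (intro allI impI)
  fix p q assume pq: "linf p \<and> linf q"
  then have p: "linf p" and q: "linf q" by auto
  have "(\<Sum>(a,b)\<leftarrow>\<Delta> g. p a * q b) = q (lsl p g)" by (simp add: linf_lsl[OF q] sw_def)
  also have "\<dots> = p g * q g" by (simp add: grouplikeD(2)[OF g p] lin_functional_scale[OF q])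
  finally show "(\<Sum>(a,b)\<leftarrow>\<Delta> g. p a * q b) = (\<Sum>(a,b)\<leftarrow>[(g, g)]. p a * q b)" by simp
qed

lemma grouplike_S:
  assumes g: "grouplike g"
  shows "S g * g = 1" "g * S g = 1" "S (S g) = g"
proof -
  have "(\<Sum>(a,b)\<leftarrow>\<Delta> g. S a * b) = (\<Sum>(a,b)\<leftarrow>[(g, g)]. S a * b)"
    using grouplike_tens[OF g]
    by (rule tens_bilin_valued) (simp add: bilin_def linf_simps)
  then show 1: "S g * g = 1"
    using sw_antipode_left[of g] by (simp add: sw_def grouplikeD(1)[OF g])
  have "(\<Sum>(a,b)\<leftarrow>\<Delta> g. a * S b) = (\<Sum>(a,b)\<leftarrow>[(g, g)]. a * S b)"
    using grouplike_tens[OF g]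
    by (rule tens_bilin_valued) (simp add: bilin_def linf_simps)
  then show 2: "g * S g = 1"
    using sw_antipode_right[of g] by (simp add: sw_def grouplikeD(1)[OF g])
  have "S g * S (S g) = 1" using arg_cong[OF 1, of S] by (simp add: S_mult S_1)
  then have "g * (S g * S (S g)) = g" by simp
  then show "S (S g) = g" by (simp add: 2 flip: mult.assoc)
qed

text \<open>A minimal nonzero subcoalgebra of D is simple, hence a line through some e, and every
  left slice of e is a multiple of e. Applying \<epsilon> to the slices shows that \<epsilon>(e) = 0
  would kill e under all functionals, so e can be rescaled to counit 1.\<close>

lemma exists_grouplike:
  assumes pt: "pointed sc \<Delta>" and D: "subcoalgebra sc \<Delta> D" "D \<noteq> {0}" "D \<subseteq> span A" "finite A"
  obtains g where "g \<in> D" "grouplike g"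
proof -
  have "subcoalgebra sc \<Delta> D \<and> D \<noteq> {0}" using D by simp
  then obtain E where E0: "subcoalgebra sc \<Delta> E \<and> E \<noteq> {0}" and ED: "E \<subseteq> D"
    and min: "\<And>D. subcoalgebra sc \<Delta> D \<and> D \<noteq> {0} \<Longrightarrow> D \<subseteq> E \<Longrightarrow> D = E"
  proof (rule exists_minimal_subspace[where P = "\<lambda>E. subcoalgebra sc \<Delta> E \<and> E \<noteq> {0}", OF _ _ D(3,4)])
  qed (simp add: subcoalgebra_iff, rule that)
  have E: "subcoalgebra sc \<Delta> E" "E \<noteq> {0}" using E0 by auto
  then have "simple_subcoalgebra sc \<Delta> E" unfolding simple_subcoalgebra_def using min by blast
  then have "dim E = 1" using pt by (simp add: pointed_def)
  moreover obtain B where B: "B \<subseteq> E" "independent B" "E \<subseteq> span B" "card B = dim E"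
    using basis_exists by blast
  ultimately obtain e where e: "B = {e}" by (auto simp: card_1_singleton_iff)
  have eE: "e \<in> E" "e \<noteq> 0" using B e dependent_zero by auto
  have eig: "lsl h e \<in> {sc c e | c. True}" if "linf h" for h
  proof -
    have "lsl h e \<in> E" using E(1) eE(1) that by (simp add: subcoalgebra_iff)
    then show ?thesis using B(3) e by (auto simp: span_singleton)
  qed
  have \<epsilon>e: "h e = c * \<epsilon> e" if "linf h" "lsl h e = sc c e" for h c
    using counit_lsl[OF that(1), of e] that(2) lin_functional_scale[OF linf_counit] by simp
  have "\<epsilon> e \<noteq> 0"
  proof
    assume "\<epsilon> e = 0"
    then have "h e = 0" if "linf h" for h using \<epsilon>e[OF that] eig[OF that] by auto
    then have "h e = h 0" if "linf h" for h using that lin_functional_0[OF that] by simp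
    then have "e = 0" by (rule eq_by_functionals)
    then show False using eE by simp
  qed
  define g where "g = sc (1 / \<epsilon> e) e"
  have "\<epsilon> g = 1" using \<open>\<epsilon> e \<noteq> 0\<close> by (simp add: g_def lin_functional_scale[OF linf_counit])
  moreover have "lsl h g = sc (h g) g" if h: "linf h" for h
  proof -
    obtain c where c: "lsl h e = sc c e" using eig[OF h] by auto
    have "h g = c" using \<epsilon>e[OF h c] \<open>\<epsilon> e \<noteq> 0\<close> by (simp add: g_def lin_functional_scale[OF h])
    then show ?thesis by (simp add: g_def lsl_scale[OF h] c mult.commute)
  qed
  ultimately have "grouplike g" by (simp add: grouplike_def)
  moreover have "g \<in> D" using E(1) ED eE(1) by (auto simp: g_def subcoalgebra_iff subspace_scale)
  ultimately show ?thesis using that by blast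
qed

text \<open>The simple subcomodules of \<open>C/N\<close> are spanned by a single vector of group-like weight. For L minimal
  among the left coideals inside C but not inside N, the coefficient coalgebra of the
  simple comodule \<open>L/(L \<inter> N)\<close> contains a group-like g, and it is a sum of copies
  \<open>rsl f ` L\<close> of this comodule; modulo a partial sum of these copies, g is the image of some l in L.\<close>

lemma exists_grouplike_vector:
  assumes pt: "pointed sc \<Delta>" and C: "subcoalgebra sc \<Delta> C" "C \<subseteq> span A" "finite A"
    and N: "left_coideal N" and CN: "\<not> C \<subseteq> N"
  obtains g m where "grouplike g" "g \<in> C" "m \<in> C" "m \<notin> N"
    "\<And>h. linf h \<Longrightarrow> lsl h m - sc (h g) m \<in> N"
proof -
  have "left_coideal C \<and> \<not> C \<subseteq> N" using C(1) CN by (simp add: left_coideal_def subcoalgebra_iff)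
  then obtain L where L0: "left_coideal L \<and> \<not> L \<subseteq> N" and "L \<subseteq> C"
    and min: "\<And>D. left_coideal D \<and> \<not> D \<subseteq> N \<Longrightarrow> D \<subseteq> L \<Longrightarrow> D = L"
  proof (rule exists_minimal_subspace[where P = "\<lambda>L. left_coideal L \<and> \<not> L \<subseteq> N", OF _ _ C(2,3)])
  qed (simp add: left_coideal_def, rule that)
  then have L: "left_coideal L" "\<not> L \<subseteq> N" "L \<subseteq> C" by auto
  note LL = left_coidealD[OF L(1)] and NN = left_coidealD[OF N]
  \<comment> \<open>V is the dual of H/N, and G consists of the matrix coefficients of the comodule
    that L defines modulo N.\<close>
  define V where "V = {f. linf f \<and> (\<forall>n\<in>N. f n = 0)}"
  define G where "G = {rsl f l | f l. f \<in> V \<and> l \<in> L}"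
  have GC: "G \<subseteq> C" using L(3) C(1) unfolding G_def V_def subcoalgebra_iff by blast
  have D: "subcoalgebra sc \<Delta> (span G)"
  proof (rule subcoalgebra_span)
    fix x h assume "x \<in> G" and h: "linf h"
    then obtain f l where x: "x = rsl f l" "linf f" "\<And>n. n \<in> N \<Longrightarrow> f n = 0" "f \<in> V" "l \<in> L"
      by (auto simp: G_def V_def)
    have "lsl h x = rsl f (lsl h l)" by (simp add: x rsl_lsl h)
    then have "lsl h x \<in> G" using x(4) LL(2)[OF x(5) h] by (auto simp: G_def)
    then show "lsl h x \<in> span G" by (rule span_base)
    define f' where "f' = sw (\<lambda>a b. h a * f b)"
    have "f' n = 0" if "n \<in> N" for n
      using x(3)[OF NN(2)[OF that h]] by (simp add: f'_def linf_lsl[OF x(2)])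
    then have "f' \<in> V" using linf_conv[OF h x(2)] by (simp add: V_def f'_def)
    moreover have "rsl h x = rsl f' l" by (simp add: x rsl_rsl h f'_def)
    ultimately have "rsl h x \<in> G" using x(5) by (auto simp: G_def)
    then show "rsl h x \<in> span G" by (rule span_base)
  qed
  have DC: "span G \<subseteq> C" using GC C(1) by (intro span_minimal) (auto simp: subcoalgebra_iff)
  have "span G \<noteq> {0}"
  proof -
    obtain l where l: "l \<in> L" "l \<notin> N" using L(2) by blast
    obtain f where f: "linf f" "\<And>z. z \<in> N \<Longrightarrow> f z = 0" "f l = 1"
      by (rule separating_functional[OF NN(1) l(2)]) (rule that)
    have "rsl f l \<in> span G" using f l by (intro span_base) (auto simp: G_def V_def)
    moreover have "rsl f l \<noteq> 0"
      using counit_rsl[OF f(1), of l] f(3) lin_functional_0[OF linf_counit] by auto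
    ultimately show ?thesis by blast
  qed
  then obtain g where g: "g \<in> span G" "grouplike g"
    using exists_grouplike[OF pt D _ _ C(3)] DC C(2) by (metis subset_trans)
  have g0: "g \<noteq> 0" using grouplikeD(1)[OF g(2)] lin_functional_0[OF linf_counit] by auto
  \<comment> \<open>\<open>Pf fs\<close> is the sum of the copies of L under \<open>rsl f\<close>
    for f in \<open>fs\<close>. Peeling the list finds the copy whose addition first captures
    g.\<close>
  define Pf where "Pf fs = foldr (\<lambda>f P. {rsl f l + p | l p. l \<in> L \<and> p \<in> P}) fs {0}" for fs
  have Pf: "Pf [] = {0}" "Pf (f # fs) = {rsl f l + p | l p. l \<in> L \<and> p \<in> Pf fs}" for f fs
    by (simp_all add: Pf_def)
  have "\<exists>fs. set fs \<subseteq> V \<and> x \<in> Pf fs" if "x \<in> span G" for x using that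
  proof (induction rule: span_induct_alt)
    case base
    then show ?case by (intro exI[of _ "[]"]) (simp add: Pf)
  next
    case (step c x y)
    then obtain f l fs where x: "x = rsl f l" "f \<in> V" "linf f" "l \<in> L" "set fs \<subseteq> V" "y \<in> Pf fs"
      by (auto simp: G_def V_def)
    have "sc c x + y = rsl f (sc c l) + y" by (simp add: x(1) rsl_scale[OF x(3)])
    moreover have "sc c l \<in> L" using LL(1) x(4) by (simp add: subspace_scale)
    ultimately have "sc c x + y \<in> Pf (f # fs)" using x(6) unfolding Pf by blast
    then show ?case using x(2,5) by (intro exI[of _ "f # fs"]) simp
  qed
  then obtain fs where fs: "set fs \<subseteq> V" "g \<in> Pf fs" using g(1) by blast
  have Pf_coideal: "left_coideal (Pf fs)" if "set fs \<subseteq> V" for fs using that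
  proof (induction fs)
    case Nil
    then show ?case by (simp add: Pf left_coideal_def lsl_0)
  next
    case (Cons f fs)
    then have IH: "subspace (Pf fs)" "\<And>x h. x \<in> Pf fs \<Longrightarrow> linf h \<Longrightarrow> lsl h x \<in> Pf fs"
      and f: "linf f" by (auto simp: left_coideal_def V_def)
    have "subspace (rsl f ` L)"
      unfolding subspace_def
    proof (intro conjI ballI allI)
      show "0 \<in> rsl f ` L" using rsl_0[OF f] subspace_0[OF LL(1)] by force
      show "x + y \<in> rsl f ` L" if "x \<in> rsl f ` L" "y \<in> rsl f ` L" for x y
        using that rsl_add[OF f] subspace_add[OF LL(1)] by (auto simp flip: rsl_add[OF f])
      show "sc c x \<in> rsl f ` L" if "x \<in> rsl f ` L" for x c
        using that subspace_scale[OF LL(1)] by (auto simp flip: rsl_scale[OF f])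
    qed
    then have "subspace {x + y | x y. x \<in> rsl f ` L \<and> y \<in> Pf fs}" using IH(1) by (rule subspace_sums)
    moreover have "{x + y | x y. x \<in> rsl f ` L \<and> y \<in> Pf fs} = Pf (f # fs)" unfolding Pf by blast
    moreover have "lsl h x \<in> Pf (f # fs)" if x: "x \<in> Pf (f # fs)" and h: "linf h" for x h
    proof -
      obtain l p where "x = rsl f l + p" "l \<in> L" "p \<in> Pf fs" using x by (auto simp: Pf)
      then have "lsl h x = rsl f (lsl h l) + lsl h p" "lsl h l \<in> L" "lsl h p \<in> Pf fs"
        using LL(2) IH(2) h f by (auto simp: lsl_add rsl_lsl)
      then show ?thesis unfolding Pf by blast
    qed
    ultimately show ?case by (simp add: left_coideal_def)
  qed
  have "\<exists>m\<in>L. m \<notin> N \<and> (\<forall>h. linf h \<longrightarrow> lsl h m - sc (h g) m \<in> N)" using fs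
  proof (induction fs)
    case Nil
    then show ?case using g0 by (simp add: Pf)
  next
    case (Cons f fs)
    show ?case
    proof (cases "g \<in> Pf fs")
      case True
      then show ?thesis using Cons by simp
    next
      case False
      obtain l p where lp: "g = rsl f l + p" "l \<in> L" "p \<in> Pf fs" using Cons.prems(2) by (auto simp: Pf)
      have f: "linf f" "\<And>n. n \<in> N \<Longrightarrow> f n = 0" using Cons.prems(1) by (auto simp: V_def)
      have "set fs \<subseteq> V" using Cons.prems(1) by simp
      note P = left_coidealD[OF Pf_coideal[OF this]]
      \<comment> \<open>\<open>L'\<close> is the part of L that \<open>rsl f\<close> sends into the
        remaining sum. It misses l, so minimality of L forces it into N; hence congruences modulo
        \<open>Pf fs\<close> lift to congruences modulo N.\<close>
      define L' where "L' = {l \<in> L. rsl f l \<in> Pf fs}"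
      have lL': "l \<notin> L'" using False lp subspace_add[OF P(1)] by (auto simp: L'_def)
      have "left_coideal L'"
        unfolding left_coideal_def
      proof (intro conjI ballI allI impI)
        show "subspace L'" using LL(1) P(1) f(1)
          by (auto simp: subspace_def L'_def rsl_0 rsl_add rsl_scale)
        show "lsl h x \<in> L'" if "x \<in> L'" "linf h" for x h
          using that LL(2) P(2) f(1) by (auto simp: L'_def rsl_lsl)
      qed
      then have L'N: "L' \<subseteq> N" using min[of L'] lL' lp(2) by (auto simp: L'_def)
      have "l \<notin> N"
      proof
        assume l: "l \<in> N"
        have "h (rsl f l) = h 0" if h: "linf h" for h
          using f(2)[OF NN(2)[OF l h]] by (simp add: linf_lsl_swap[OF f(1) h] lin_functional_0[OF h])
        then have "rsl f l = 0" by (rule eq_by_functionals)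
        then show False using lp False by simp
      qed
      moreover have "lsl h l - sc (h g) l \<in> N" if h: "linf h" for h
      proof -
        \<comment> \<open>Here \<open>rsl f l\<close> equals g up to p, and g is an eigenvector of
          all left slices. The g-terms therefore cancel and only terms in p are left.\<close>
        have l: "rsl f l = g - p" using lp(1) by simp
        have fd: "rsl f (x - y) = rsl f x - rsl f y" for x y using rsl_add[OF f(1), of "x - y" y] by simp
        have "rsl f (lsl h l - sc (h g) l) = lsl h (g - p) - sc (h g) (g - p)"
          by (simp only: fd rsl_scale[OF f(1)] rsl_lsl[OF f(1) h] l)
        also have "\<dots> = sc (h g) p - lsl h p"
          by (simp add: lsl_diff[OF h] grouplikeD(2)[OF g(2) h] scale_right_diff_distrib)
        also have "\<dots> \<in> Pf fs"
          using lp(3) P h by (intro subspace_diff subspace_scale) auto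
        finally have "lsl h l - sc (h g) l \<in> L'"
          unfolding L'_def using lp(2) LL h by (auto intro!: subspace_diff subspace_scale)
        then show ?thesis using L'N by blast
      qed
      ultimately show ?thesis using lp(2) by blast
    qed
  qed
  then show ?thesis using that g L(3) DC by blast
qed

text \<open>The left module \<open>(N + K m)/N\<close> is free: the annihilator of m is a Hopf submodule of K,
  so it contains 1 as soon as it is not zero.\<close>

lemma grouplike_vector_free:
  assumes K: "hopf_subalgebra sc \<Delta> S K" and N: "left_coideal N"
    and KN: "\<And>k n. k \<in> K \<Longrightarrow> n \<in> N \<Longrightarrow> k * n \<in> N"
    and g: "grouplike g" and m: "m \<notin> N" "\<And>h. linf h \<Longrightarrow> lsl h m - sc (h g) m \<in> N"
    and k: "k \<in> K" "k * m \<in> N"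
  shows "k = 0"
proof -
  have sub: "subalgebra sc K" using K by (simp add: hopf_subalgebra_def)
  have KS: "x \<in> K \<Longrightarrow> S x \<in> K" and Ksl: "x \<in> K \<Longrightarrow> linf h \<Longrightarrow> lsl h x \<in> K"
    "x \<in> K \<Longrightarrow> linf h \<Longrightarrow> rsl h x \<in> K" for x h
    using K by (auto simp: hopf_subalgebra_iff)
  note NN = left_coidealD[OF N]
  define I where "I = {k \<in> K. k * m \<in> N}"
  have I_sub: "subspace I"
    using subalgebraD(1)[OF sub] NN(1) by (auto simp: I_def subspace_def distrib_right)
  have I_slice: "lsl h j \<in> I" if j: "j \<in> I" and h: "linf h" for j h
  proof -
    have jK: "j \<in> K" "j * m \<in> N" using j by (auto simp: I_def)
    obtain u where u: "tens_eq sc (\<Delta> j) u" "set u \<subseteq> K \<times> K"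
      using hopf_subalgebra_tens[OF K jK(1)] .
    \<comment> \<open>Modulo N the coproduct of j m is that of j multiplied by the tensor of g and
      m. Right multiplication by S g inside h cancels the factor g.\<close>
    define h' where "h' z = h (z * S g)" for z
    have h': "linf h'" unfolding h'_def using h by (rule linf_comp)
    have "lsl h' (j * m) = (\<Sum>(a,b)\<leftarrow>u. b * lsl (\<lambda>z. h' (a * z)) m)" by (rule lsl_mult[OF u(1) h'])
    then have 1: "(\<Sum>p\<leftarrow>u. snd p * lsl (\<lambda>z. h' (fst p * z)) m) \<in> N"
      using NN(2)[OF jK(2) h'] by (simp add: case_prod_unfold)
    have "snd p * lsl (\<lambda>z. h' (fst p * z)) m - sc (h (fst p)) (snd p * m) \<in> N" if "p \<in> set u" for p
    proof -
      have lin: "linf (\<lambda>z. h' (fst p * z))" using h' by (rule linf_comp)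
      have "h' (fst p * g) = h (fst p)" by (simp add: h'_def mult.assoc grouplike_S(2)[OF g])
      then have "lsl (\<lambda>z. h' (fst p * z)) m - sc (h (fst p)) m \<in> N" using m(2)[OF lin] by simp
      then have "snd p * (lsl (\<lambda>z. h' (fst p * z)) m - sc (h (fst p)) m) \<in> N"
        using u(2) that by (intro KN) auto
      then show ?thesis by (simp add: right_diff_distrib)
    qed
    then have 2: "(\<Sum>p\<leftarrow>u. snd p * lsl (\<lambda>z. h' (fst p * z)) m - sc (h (fst p)) (snd p * m)) \<in> N"
      by (intro subspace_sum_list NN(1))
    have "(\<Sum>p\<leftarrow>u. sc (h (fst p)) (snd p * m)) \<in> N"
      using subspace_diff[OF NN(1) 1 2] by (simp add: sum_list_subtractf)
    moreover have "lsl h j = (\<Sum>(a,b)\<leftarrow>u. sc (h a) b)" unfolding lsl_def sw_def using u(1)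
      by (rule tens_bilin_valued) (use h in \<open>simp add: bilin_def linf_simps\<close>)
    then have "lsl h j * m = (\<Sum>p\<leftarrow>u. sc (h (fst p)) (snd p * m))"
      by (simp add: case_prod_unfold flip: sum_list_mult_const)
    ultimately show ?thesis using Ksl(1)[OF jK(1) h] by (simp add: I_def)
  qed
  \<comment> \<open>If \<epsilon>(j) were nonzero, then \<epsilon>(j) 1 = S(j1) j2 would put 1 into
    I: slices j2 of j stay in I, and I absorbs left factors from K. But 1 in I means that m is in
    N.\<close>
  have I_counit: "\<epsilon> j = 0" if j: "j \<in> I" for j
  proof (rule ccontr)
    assume nz: "\<epsilon> j \<noteq> 0"
    have jK: "j \<in> K" using j by (auto simp: I_def)
    obtain u where u: "tens_eq sc (\<Delta> j) u"
      "set u \<subseteq> {rsl g j | g. linf g} \<times> {lsl h j | h. linf h}" by (rule tens_slices)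
    have "sc (\<epsilon> j) 1 = (\<Sum>(a,b)\<leftarrow>u. S a * b)" unfolding sw_antipode_left[symmetric] sw_def using u(1)
      by (rule tens_bilin_valued) (simp add: bilin_def linf_simps)
    moreover have "(\<Sum>(a,b)\<leftarrow>u. S a * b) \<in> I"
    proof (rule subspace_sum_list[OF I_sub])
      fix p assume "p \<in> set u"
      then have "fst p \<in> K" "snd p \<in> I" using u(2) Ksl(2)[OF jK] I_slice[OF j] by auto
      then have "S (fst p) * snd p \<in> I"
        using KS KN subalgebraD(3)[OF sub] by (simp add: I_def mult.assoc)
      then show "(case p of (a, b) \<Rightarrow> S a * b) \<in> I" by (simp add: case_prod_unfold)
    qed
    ultimately have "sc (1 / \<epsilon> j) (sc (\<epsilon> j) 1) \<in> I" using subspace_scale[OF I_sub] by simp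
    then have "m \<in> N" using nz by (simp add: I_def)
    then show False using m(1) by simp
  qed
  have kI: "k \<in> I" using k by (simp add: I_def)
  show "k = 0"
  proof (rule eq_by_functionals)
    fix h assume h: "linf h"
    have "h k = \<epsilon> (lsl h k)" by (rule counit_lsl[OF h, symmetric])
    also have "\<dots> = 0" by (rule I_counit[OF I_slice[OF kI h]])
    finally show "h k = h 0" by (simp add: lin_functional_0[OF h])
  qed
qed

text \<open>This is K + K^+ N. For a Hopf submodule N the quotient of N by it is the tensor product
  over K of the trivial module with N/K.\<close>

definition aug_span :: "'h set \<Rightarrow> 'h set \<Rightarrow> 'h set" where
  "aug_span K N = span (K \<union> {k * n | k n. k \<in> K \<and> \<epsilon> k = 0 \<and> n \<in> N})"

definition hopf_submodule :: "'h set \<Rightarrow> 'h set \<Rightarrow> bool" where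
  "hopf_submodule K N \<longleftrightarrow> left_coideal N \<and> K \<subseteq> N \<and> (\<forall>k\<in>K. \<forall>n\<in>N. k * n \<in> N)"

text \<open>Modulo N the coproduct of k m consists of tensors of k1 g with k2 m, so N + K m is again
  a left coideal. For the last inclusion, K^+ K lies in K^+, hence adjoining m enlarges K + K^+ N by
  at most K^+ m.\<close>

lemma hopf_submodule_extend:
  assumes K: "hopf_subalgebra sc \<Delta> S K" and N: "hopf_submodule K N"
    and m: "\<And>h. linf h \<Longrightarrow> lsl h m - sc (h g) m \<in> N"
  defines "N' \<equiv> {n + k * m | n k. n \<in> N \<and> k \<in> K}"
  shows "hopf_submodule K N'" "N \<subseteq> N'" "m \<in> N'"
    "aug_span K N' \<subseteq> {j + k * m | j k. j \<in> aug_span K N \<and> k \<in> K \<and> \<epsilon> k = 0}"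
proof -
  have sub: "subalgebra sc K" using K by (simp add: hopf_subalgebra_def)
  note KK = subalgebraD[OF sub]
  have lc: "left_coideal N" and KN: "K \<subseteq> N" "\<And>k n. k \<in> K \<Longrightarrow> n \<in> N \<Longrightarrow> k * n \<in> N"
    using N by (auto simp: hopf_submodule_def)
  note NN = left_coidealD[OF lc]
  have memI: "n + k * m \<in> N'" if "n \<in> N" "k \<in> K" for n k using that unfolding N'_def by blast
  show NN': "N \<subseteq> N'" using memI[of _ 0] subspace_0[OF KK(1)] by auto
  show "m \<in> N'" using memI[of 0 1] subspace_0[OF NN(1)] KK(2) by simp
  have add: "x + y \<in> N'" if "x \<in> N'" "y \<in> N'" for x y
  proof -
    obtain n k n' k' where "x = n + k * m" "y = n' + k' * m" "n \<in> N" "n' \<in> N" "k \<in> K" "k' \<in> K"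
      using \<open>x \<in> N'\<close> \<open>y \<in> N'\<close> by (auto simp: N'_def)
    then have "x + y = (n + n') + (k + k') * m" "n + n' \<in> N" "k + k' \<in> K"
      by (auto simp: algebra_simps subspace_add[OF NN(1)] subspace_add[OF KK(1)])
    then show ?thesis using memI by simp
  qed
  have sub': "subspace N'"
    unfolding subspace_def
  proof (intro conjI ballI allI)
    show "0 \<in> N'" using NN' subspace_0[OF NN(1)] by blast
    show "x + y \<in> N'" if "x \<in> N'" "y \<in> N'" for x y using that by (rule add)
    fix c x assume "x \<in> N'"
    then obtain n k where "x = n + k * m" "n \<in> N" "k \<in> K" by (auto simp: N'_def)
    then have "sc c x = sc c n + sc c k * m" "sc c n \<in> N" "sc c k \<in> K"
      by (auto simp: scale_right_distrib subspace_scale[OF NN(1)] subspace_scale[OF KK(1)])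
    then show "sc c x \<in> N'" using memI[of "sc c n" "sc c k"] by simp
  qed
  have km: "lsl h (k * m) \<in> N'" if k: "k \<in> K" and h: "linf h" for k h
  proof -
    obtain u where u: "tens_eq sc (\<Delta> k) u" "set u \<subseteq> K \<times> K"
      using hopf_subalgebra_tens[OF K k] .
    have "b * lsl (\<lambda>z. h (a * z)) m \<in> N'" if "(a, b) \<in> set u" for a b
    proof -
      have b: "b \<in> K" using u(2) that by auto
      have "linf (\<lambda>z. h (a * z))" using h by (rule linf_comp)
      from KN(2)[OF b m[OF this]]
      have "b * (lsl (\<lambda>z. h (a * z)) m - sc (h (a * g)) m) + sc (h (a * g)) b * m \<in> N'"
        using b by (intro memI) (auto simp: subspace_scale[OF KK(1)])
      then show ?thesis by (simp add: right_diff_distrib)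
    qed
    then show ?thesis unfolding lsl_mult[OF u(1) h] by (intro subspace_sum_list[OF sub']) auto
  qed
  have "lsl h x \<in> N'" if "x \<in> N'" and h: "linf h" for x h
  proof -
    obtain n k where x: "x = n + k * m" "n \<in> N" "k \<in> K" using \<open>x \<in> N'\<close> by (auto simp: N'_def)
    then show ?thesis using add km[OF x(3) h] NN(2)[OF x(2) h] NN' by (auto simp: lsl_add[OF h])
  qed
  then have "left_coideal N'" using sub' by (simp add: left_coideal_def)
  moreover have mult: "k * x \<in> N'" if "k \<in> K" "x \<in> N'" for k x
  proof -
    obtain n k' where x: "x = n + k' * m" "n \<in> N" "k' \<in> K" using \<open>x \<in> N'\<close> by (auto simp: N'_def)
    then have "k * x = k * n + (k * k') * m" by (simp add: distrib_left mult.assoc)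
    then show ?thesis using memI KN(2) KK(3) x \<open>k \<in> K\<close> by simp
  qed
  ultimately show "hopf_submodule K N'" using KN(1) NN' by (auto simp: hopf_submodule_def)
  define T where "T = {j + k * m | j k. j \<in> aug_span K N \<and> k \<in> K \<and> \<epsilon> k = 0}"
  have \<epsilon>0: "\<epsilon> 0 = 0" by (rule lin_functional_0[OF linf_counit])
  have TI: "j + k * m \<in> T" if "j \<in> aug_span K N" "k \<in> K" "\<epsilon> k = 0" for j k
    using that unfolding T_def by blast
  have sJ: "subspace (aug_span K N)" by (simp add: aug_span_def)
  have "subspace T"
    unfolding subspace_def
  proof (intro conjI ballI allI)
    show "0 \<in> T" using TI[of 0 0] subspace_0[OF sJ] subspace_0[OF KK(1)] \<epsilon>0 by simp
    fix x assume "x \<in> T"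
    then obtain j k where x: "x = j + k * m" "j \<in> aug_span K N" "k \<in> K" "\<epsilon> k = 0"
      unfolding T_def by blast
    have "sc c x = sc c j + sc c k * m" for c by (simp add: x(1) scale_right_distrib)
    then show "sc c x \<in> T" for c
      using TI[of "sc c j" "sc c k"] x
      by (simp add: subspace_scale[OF sJ] subspace_scale[OF KK(1)] lin_functional_scale[OF linf_counit])
    fix y assume "y \<in> T"
    then obtain j' k' where y: "y = j' + k' * m" "j' \<in> aug_span K N" "k' \<in> K" "\<epsilon> k' = 0"
      unfolding T_def by blast
    have "x + y = (j + j') + (k + k') * m" by (simp add: x(1) y(1) algebra_simps)
    also have "\<dots> \<in> T"
      using x y by (intro TI subspace_add[OF sJ] subspace_add[OF KK(1)])
        (auto simp: lin_functional_add[OF linf_counit])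
    finally show "x + y \<in> T" .
  qed
  moreover have "K \<union> {k * n | k n. k \<in> K \<and> \<epsilon> k = 0 \<and> n \<in> N'} \<subseteq> T"
  proof
    fix x assume "x \<in> K \<union> {k * n | k n. k \<in> K \<and> \<epsilon> k = 0 \<and> n \<in> N'}"
    then consider "x \<in> K" | k n k' where "k \<in> K" "\<epsilon> k = 0" "n \<in> N" "k' \<in> K" "x = k * (n + k' * m)"
      unfolding N'_def by blast
    then show "x \<in> T"
    proof cases
      case 1
      then have "x \<in> aug_span K N" unfolding aug_span_def by (intro span_base) blast
      then show ?thesis using TI[of x 0] subspace_0[OF KK(1)] \<epsilon>0 by simp
    next
      case 2
      then have "k * n \<in> aug_span K N" unfolding aug_span_def by (intro span_base) blast
      moreover have "x = k * n + (k * k') * m" using 2 by (simp add: distrib_left mult.assoc)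
      ultimately show ?thesis using TI[of "k * n" "k * k'"] 2 KK(3) by (simp add: counit_mult)
    qed
  qed
  ultimately have "aug_span K N' \<subseteq> T" unfolding aug_span_def[of K N'] by (intro span_minimal)
  then show "aug_span K N' \<subseteq> {j + k * m | j k. j \<in> aug_span K N \<and> k \<in> K \<and> \<epsilon> k = 0}"
    by (simp add: T_def)
qed

text \<open>Transfinitely, H is exhausted from K by Hopf submodules with free subquotients;
  hence \<open>m0\<close> stays outside of \<open>K + K\<^sup>+ N\<close> along the way.\<close>

lemma pointed_aug_span:
  assumes pt: "pointed sc \<Delta>" and K: "hopf_subalgebra sc \<Delta> S K" and nK: "K \<noteq> UNIV"
  obtains m where "m \<notin> aug_span K UNIV"
proof -
  have sub: "subalgebra sc K" using K by (simp add: hopf_subalgebra_def)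
  note KK = subalgebraD[OF sub]
  have step: "\<exists>g m. grouplike g \<and> m \<notin> N \<and> (\<forall>h. linf h \<longrightarrow> lsl h m - sc (h g) m \<in> N)"
    if "left_coideal N" "N \<noteq> UNIV" for N
  proof -
    obtain x where x: "x \<notin> N" using \<open>N \<noteq> UNIV\<close> by blast
    obtain C A where C: "subcoalgebra sc \<Delta> C" "{x} \<subseteq> C" "finite A" "C = span A"
      by (rule finite_subcoalgebra[of "{x}"]) (simp, rule that)
    have "C \<subseteq> span A" "\<not> C \<subseteq> N" using C x by auto
    then obtain g m where "grouplike g" "g \<in> C" "m \<in> C" "m \<notin> N" "\<And>h. linf h \<Longrightarrow> lsl h m - sc (h g) m \<in> N"
      using exists_grouplike_vector[OF pt C(1) _ C(3) \<open>left_coideal N\<close>] by metis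
    then show ?thesis by blast
  qed
  have free: "k = 0" if "hopf_submodule K N" "grouplike g" "m \<notin> N"
    "\<forall>h. linf h \<longrightarrow> lsl h m - sc (h g) m \<in> N" "k \<in> K" "k * m \<in> N" for N g m k
    using that unfolding hopf_submodule_def by (intro grouplike_vector_free[OF K, of N g m k]) auto
  have aug_sub: "aug_span K N \<subseteq> N" if "hopf_submodule K N" for N
    using that unfolding aug_span_def hopf_submodule_def left_coideal_def by (intro span_minimal) auto
  have KK': "hopf_submodule K K"
    using K KK by (auto simp: hopf_submodule_def left_coideal_def hopf_subalgebra_iff)
  then have "left_coideal K" by (simp add: hopf_submodule_def)
  from step[OF this nK] obtain g0 m0 where m0: "grouplike g0" "m0 \<notin> K"
    "\<forall>h. linf h \<longrightarrow> lsl h m0 - sc (h g0) m0 \<in> K" by blast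
  define N0 where "N0 = {n + k * m0 | n k. n \<in> K \<and> k \<in> K}"
  note ext0 = hopf_submodule_extend[OF K KK' m0(3)[rule_format], folded N0_def]
  \<comment> \<open>Membership of m0 in N is part of the family for the sake of the extension step:
    there m0 = j + k m has to give that k m lies in N.\<close>
  define \<N> where "\<N> = {N. hopf_submodule K N \<and> m0 \<in> N \<and> m0 \<notin> aug_span K N}"
  have "m0 \<notin> aug_span K N0"
  proof
    assume "m0 \<in> aug_span K N0"
    then obtain j k where jk: "m0 = j + k * m0" "j \<in> aug_span K K" "k \<in> K" "\<epsilon> k = 0"
      using ext0(4) by blast
    \<comment> \<open>Freeness of K m0 modulo K would make 1 - k zero, although its counit is
      1.\<close>
    have "(1 - k) * m0 = j" using jk(1) by (simp add: left_diff_distrib) (metis add_diff_cancel_right')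
    then have "(1 - k) * m0 \<in> K" using jk(2) aug_sub[OF KK'] by auto
    moreover have "1 - k \<in> K" using KK(2) jk(3) by (rule subspace_diff[OF KK(1)])
    ultimately have "1 - k = 0" using free[OF KK' m0] by blast
    then show False using jk(4) counit_1 by simp
  qed
  then have "N0 \<in> \<N>" using ext0(1,3) by (simp add: \<N>_def)
  moreover have "\<Union>\<C> \<in> \<N>" if \<C>: "\<C> \<noteq> {}" "subset.chain \<N> \<C>" for \<C>
  proof -
    have sub\<N>: "\<And>N. N \<in> \<C> \<Longrightarrow> N \<in> \<N>" and tot: "\<And>N M. N \<in> \<C> \<Longrightarrow> M \<in> \<C> \<Longrightarrow> N \<subseteq> M \<or> M \<subseteq> N"
      using \<C>(2) by (auto simp: subset_chain_def)
    then have sm: "\<And>N. N \<in> \<C> \<Longrightarrow> hopf_submodule K N" by (auto simp: \<N>_def)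
    \<comment> \<open>Used for the members of the chain and for their spans
      \<open>aug_span K N\<close>: forming \<open>aug_span\<close> commutes with unions of chains,
      so m0 is not captured in the limit.\<close>
    have directed: "subspace (\<Union>(f ` \<C>))"
      if sb: "\<And>N. N \<in> \<C> \<Longrightarrow> subspace (f N)" and mn: "\<And>N M. N \<subseteq> M \<Longrightarrow> f N \<subseteq> f M" for f :: "'h set \<Rightarrow> 'h set"
      unfolding subspace_def
    proof (intro conjI ballI allI)
      show "0 \<in> \<Union>(f ` \<C>)" using \<C>(1) sb subspace_0 by blast
      show "sc c x \<in> \<Union>(f ` \<C>)" if "x \<in> \<Union>(f ` \<C>)" for c x
        using that sb subspace_scale by blast
      fix x y assume "x \<in> \<Union>(f ` \<C>)" "y \<in> \<Union>(f ` \<C>)"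
      then obtain N M where NM: "N \<in> \<C>" "M \<in> \<C>" "x \<in> f N" "y \<in> f M" by blast
      then obtain L where "L \<in> \<C>" "x \<in> f L" "y \<in> f L" using tot[OF NM(1,2)] mn by blast
      then show "x + y \<in> \<Union>(f ` \<C>)" using sb subspace_add by blast
    qed
    have subs: "\<And>N. N \<in> \<C> \<Longrightarrow> subspace N" using sm by (simp add: hopf_submodule_def left_coideal_def)
    have "subspace (\<Union>\<C>)" using directed[of "\<lambda>N. N"] subs by simp
    moreover have "lsl h x \<in> \<Union>\<C>" if "x \<in> \<Union>\<C>" "linf h" for x h
      using that sm unfolding hopf_submodule_def left_coideal_def by blast
    moreover have "K \<subseteq> \<Union>\<C>" using \<C>(1) sm unfolding hopf_submodule_def by blast
    moreover have "k * n \<in> \<Union>\<C>" if "k \<in> K" "n \<in> \<Union>\<C>" for k n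
      using that sm unfolding hopf_submodule_def by blast
    ultimately have "hopf_submodule K (\<Union>\<C>)" by (simp add: hopf_submodule_def left_coideal_def)
    moreover have "m0 \<in> \<Union>\<C>" using \<C>(1) sub\<N> by (auto simp: \<N>_def)
    moreover have "m0 \<notin> aug_span K (\<Union>\<C>)"
    proof -
      have "subspace (\<Union>(aug_span K ` \<C>))"
      proof (rule directed)
        show "subspace (aug_span K N)" for N by (simp add: aug_span_def)
        show "aug_span K N \<subseteq> aug_span K M" if "N \<subseteq> M" for N M
          unfolding aug_span_def using that by (intro span_mono) blast
      qed
      moreover have "K \<union> {k * n | k n. k \<in> K \<and> \<epsilon> k = 0 \<and> n \<in> \<Union>\<C>} \<subseteq> \<Union>(aug_span K ` \<C>)"
      proof
        fix x assume "x \<in> K \<union> {k * n | k n. k \<in> K \<and> \<epsilon> k = 0 \<and> n \<in> \<Union>\<C>}"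
        then obtain N where N: "N \<in> \<C>" "x \<in> K \<union> {k * n | k n. k \<in> K \<and> \<epsilon> k = 0 \<and> n \<in> N}"
          using \<C>(1) by blast
        then have "x \<in> aug_span K N" unfolding aug_span_def by (intro span_base)
        then show "x \<in> \<Union>(aug_span K ` \<C>)" using N(1) by blast
      qed
      ultimately have "aug_span K (\<Union>\<C>) \<subseteq> \<Union>(aug_span K ` \<C>)"
        unfolding aug_span_def[of K "\<Union>\<C>"] by (intro span_minimal)
      then show ?thesis using sub\<N> by (auto simp: \<N>_def)
    qed
    ultimately show ?thesis by (simp add: \<N>_def)
  qed
  ultimately obtain N where N: "N \<in> \<N>" and max: "\<And>M. M \<in> \<N> \<Longrightarrow> N \<subseteq> M \<Longrightarrow> M = N"
    using subset_Zorn_nonempty[of \<N>] by blast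
  have Nsm: "hopf_submodule K N" "m0 \<in> N" "m0 \<notin> aug_span K N" using N by (auto simp: \<N>_def)
  have "N = UNIV"
  proof (rule ccontr)
    assume nU: "N \<noteq> UNIV"
    have "left_coideal N" using Nsm by (simp add: hopf_submodule_def)
    from step[OF this nU] obtain g m where m: "grouplike g" "m \<notin> N"
      "\<forall>h. linf h \<longrightarrow> lsl h m - sc (h g) m \<in> N" by blast
    define N' where "N' = {n + k * m | n k. n \<in> N \<and> k \<in> K}"
    note ext = hopf_submodule_extend[OF K Nsm(1) m(3)[rule_format], folded N'_def]
    have "m0 \<notin> aug_span K N'"
    proof
      assume "m0 \<in> aug_span K N'"
      then obtain j k where jk: "m0 = j + k * m" "j \<in> aug_span K N" "k \<in> K" "\<epsilon> k = 0"
        using ext(4) by blast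
      have "k * m = m0 - j" using jk(1) by simp
      moreover have "m0 - j \<in> N"
        using Nsm jk(2) aug_sub[OF Nsm(1)] by (auto simp: hopf_submodule_def left_coideal_def intro!: subspace_diff)
      ultimately have "k = 0" using free[OF Nsm(1) m jk(3)] by simp
      then show False using jk(1,2) Nsm(3) by simp
    qed
    then have "N' \<in> \<N>" using ext(1,2) Nsm(2) by (auto simp: \<N>_def)
    then show False using max[OF _ ext(2)] ext(3) m(2) by blast
  qed
  then show ?thesis using that Nsm(3) by blast
qed

text \<open>A functional q that kills K + K^+ H satisfies q(k y) = \<epsilon>(k) q(y), so
  \<epsilon>(x) q(y) is a balanced form. Its value is q(m) = 1 at (1, m) but 0 at (m, 1), against
  symmetry.\<close>

lemma pointed_eq_UNIV:
  assumes pt: "pointed sc \<Delta>" and K: "hopf_subalgebra sc \<Delta> S K"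
    and F: "F \<subseteq> K" "\<And>x. x \<in> F \<Longrightarrow> \<epsilon> x = 0"
    and gen: "\<And>I. left_ideal I \<Longrightarrow> F \<subseteq> I \<Longrightarrow> {x. \<epsilon> x = 0} \<subseteq> I"
  shows "K = UNIV"
proof (rule ccontr)
  assume "K \<noteq> UNIV"
  then obtain m where m: "m \<notin> aug_span K UNIV" by (rule pointed_aug_span[OF pt K])
  have KK: "subspace K" "1 \<in> K"
    using K subalgebraD unfolding hopf_subalgebra_def by blast+
  have "subspace (aug_span K UNIV)" by (simp add: aug_span_def)
  then obtain q where q: "linf q" "\<And>z. z \<in> aug_span K UNIV \<Longrightarrow> q z = 0" "q m = 1"
    using separating_functional[OF _ m] by metis
  have q1: "q 1 = 0" using KK(2) by (intro q(2)) (auto simp: aug_span_def intro!: span_base)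
  have qK: "q (k * y) = \<epsilon> k * q y" if k: "k \<in> K" for k y
  proof -
    have "k - sc (\<epsilon> k) 1 \<in> K" using KK k by (simp add: subspace_diff subspace_scale)
    moreover have "\<epsilon> (k - sc (\<epsilon> k) 1) = 0"
      by (simp add: lin_functional_diff[OF linf_counit] lin_functional_scale[OF linf_counit] counit_1)
    ultimately have "q ((k - sc (\<epsilon> k) 1) * y) = 0"
      unfolding aug_span_def by (intro q(2)[unfolded aug_span_def] span_base) blast
    then show ?thesis
      by (simp add: left_diff_distrib lin_functional_diff[OF q(1)] lin_functional_scale[OF q(1)])
  qed
  define \<beta> where "\<beta> x y = \<epsilon> x * q y" for x y
  have "bilin \<beta>" unfolding \<beta>_def by (rule bilin_mult[OF linf_counit q(1)])
  moreover have "\<beta> (x * k) y = \<beta> x (k * y)" if "k \<in> K" for x k y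
    using qK[OF that] by (simp add: \<beta>_def counit_mult)
  ultimately have "\<beta> m 1 = \<beta> 1 m"
    using balanced_form_symmetric[where \<beta> = \<beta> and h = m and F = F and K = K, OF K F gen] by blast
  then show False using q(3) q1 by (simp add: \<beta>_def counit_1)
qed

text \<open>Adjoining the inverses of the group-like elements of C already makes the algebra
  generated by C stable under S.\<close>

lemma pointed_finitely_generated:
  assumes pt: "pointed sc \<Delta>" and C: "subcoalgebra sc \<Delta> C" "C = span A" "finite A"
  obtains F where "finite F" "(\<Union>i. (S ^^ i) ` C) \<subseteq> alg_gen sc F"
proof -
  define W where "W = S ` {g \<in> C. grouplike g}"
  have Sspan: "S c \<in> span (S ` A)" if "c \<in> span A" for c using that
  proof (induction rule: span_induct_alt)
    case base
    have "S 0 = 0" using S_scale[of 0 0] by simp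
    then show ?case by (simp add: span_zero)
  next
    case (step c x y)
    then have "S x \<in> span (S ` A)" by (intro span_base imageI)
    then show ?case using step(2) by (simp add: S_add S_scale span_add span_scale)
  qed
  \<comment> \<open>W lies in the finite-dimensional space S(C), so finitely many of the inverses
    span all of them and can serve as generators.\<close>
  obtain B where B: "B \<subseteq> W" "independent B" "W \<subseteq> span B"
    using maximal_independent_subset by metis
  have "W \<subseteq> span (S ` A)" using Sspan C(2) by (auto simp: W_def)
  then have "finite B" using independent_span_bound[of "S ` A" B] B C(3) by auto
  define R where "R = alg_gen sc (A \<union> B)"
  have R: "subalgebra sc R" unfolding R_def by (rule subalgebra_alg_gen)
  note RR = subalgebraD[OF R]
  have AB: "A \<union> B \<subseteq> R" unfolding R_def by (rule alg_gen_superset)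
  then have CR: "C \<subseteq> R" and WR: "W \<subseteq> R"
    using span_minimal[OF _ RR(1), of A] span_minimal[OF _ RR(1), of B] B(3) C(2) by auto
  \<comment> \<open>The condition concerns all slices of c so that N is a left coideal; slicing by
    \<epsilon> shows that S maps N itself into R.\<close>
  define N where "N = {c \<in> C. \<forall>h. linf h \<longrightarrow> S (lsl h c) \<in> R}"
  have S0: "S 0 = 0" using S_scale[of 0 0] by simp
  have CC: "subspace C" "\<And>x h. x \<in> C \<Longrightarrow> linf h \<Longrightarrow> lsl h x \<in> C" "\<And>x h. x \<in> C \<Longrightarrow> linf h \<Longrightarrow> rsl h x \<in> C"
    using C(1) by (auto simp: subcoalgebra_iff)
  have N: "left_coideal N"
    unfolding left_coideal_def
  proof (intro conjI ballI allI impI)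
    show "subspace N" unfolding subspace_def N_def
      by (auto simp: lsl_0 lsl_add lsl_scale S0 S_add S_scale subspace_0[OF CC(1)] subspace_add[OF CC(1)]
          subspace_scale[OF CC(1)] subspace_0[OF RR(1)] subspace_add[OF RR(1)] subspace_scale[OF RR(1)])
    fix x h assume x: "x \<in> N" and h: "linf h"
    have "S (lsl h' (lsl h x)) \<in> R" if "linf h'" for h'
      using x linf_conv[OF h that] by (simp add: N_def lsl_lsl[OF that h])
    then show "lsl h x \<in> N" using x CC(2) h by (simp add: N_def)
  qed
  have SN: "S n \<in> R" if "n \<in> N" for n
    using that linf_counit lsl_counit[of n] unfolding N_def by force
  have CN: "C \<subseteq> N"
  proof (rule ccontr)
    assume neg: "\<not> C \<subseteq> N"
    have "C \<subseteq> span A" using C(2) by simp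
    from exists_grouplike_vector[OF pt C(1) this C(3) N neg]
    obtain g m where g: "grouplike g" "g \<in> C" and m: "m \<in> C" "m \<notin> N"
      "\<And>h. linf h \<Longrightarrow> lsl h m - sc (h g) m \<in> N" by metis
    obtain f where f: "linf f" "\<And>z. z \<in> N \<Longrightarrow> f z = 0" "f m = 1"
      by (rule separating_functional[OF left_coidealD(1)[OF N] m(2)]) (rule that)
    obtain u where u: "tens_eq sc (\<Delta> m) u"
      "set u \<subseteq> {rsl g m | g. linf g} \<times> {lsl h m | h. linf h}" by (rule tens_slices)
    have fm: "f (lsl h m) = h g" if "linf h" for h
    proof -
      have "f (lsl h m - sc (h g) m) = 0" using m(3)[OF that] by (rule f(2))
      then show ?thesis
        using f(3) by (simp add: lin_functional_diff[OF f(1)] lin_functional_scale[OF f(1)])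
    qed
    have uN: "fst p \<in> C \<and> snd p - sc (f (snd p)) m \<in> N" if p: "p \<in> set u" for p
      using p u(2) m(1,3) CC(3) fm by auto
    have "rsl f m = g"
      by (rule eq_by_functionals) (simp add: fm flip: linf_lsl_swap[OF f(1)])
    moreover have "rsl f m = (\<Sum>(a,b)\<leftarrow>u. sc (f b) a)" unfolding rsl_def sw_def using u(1)
      by (rule tens_bilin_valued) (use f(1) in \<open>simp add: bilin_def linf_simps\<close>)
    ultimately have gu: "(\<Sum>p\<leftarrow>u. sc (f (snd p)) (fst p)) = g" by (simp add: case_prod_unfold)
    \<comment> \<open>In \<epsilon>(m) 1 = m1 S(m2) the leg m2 is congruent to f(m2) m modulo N. The
      multiples of S(m) add up to g S(m), because m1 f(m2) = g, and the other terms lie in R. As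
      S(g) is an inverse of g inside R, S(m) lies in R too.\<close>
    have "sc (\<epsilon> m) 1 = (\<Sum>(a,b)\<leftarrow>u. a * S b)" unfolding sw_antipode_right[symmetric] sw_def using u(1)
      by (rule tens_bilin_valued) (simp add: bilin_def linf_simps)
    also have "\<dots> = (\<Sum>p\<leftarrow>u. fst p * S (snd p - sc (f (snd p)) m) + sc (f (snd p)) (fst p) * S m)"
    proof (intro arg_cong[where f = sum_list] map_cong refl)
      fix p :: "'h \<times> 'h"
      have "S (snd p) = S (snd p - sc (f (snd p)) m) + sc (f (snd p)) (S m)"
        by (simp flip: S_add S_scale)
      then show "(case p of (a, b) \<Rightarrow> a * S b)
        = fst p * S (snd p - sc (f (snd p)) m) + sc (f (snd p)) (fst p) * S m"
        by (simp add: case_prod_unfold distrib_left)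
    qed
    also have "\<dots> = (\<Sum>p\<leftarrow>u. fst p * S (snd p - sc (f (snd p)) m)) + g * S m"
      unfolding gu[symmetric] sum_list_addf sum_list_mult_const ..
    finally have "g * S m = sc (\<epsilon> m) 1 - (\<Sum>p\<leftarrow>u. fst p * S (snd p - sc (f (snd p)) m))"
      by (simp add: algebra_simps)
    also have "\<dots> \<in> R"
    proof (intro subspace_diff[OF RR(1)] subspace_scale[OF RR(1)] RR(2) subspace_sum_list[OF RR(1)])
      fix p assume "p \<in> set u"
      from uN[OF this] show "fst p * S (snd p - sc (f (snd p)) m) \<in> R"
        using CR SN RR(3) by blast
    qed
    finally have "g * S m \<in> R" .
    moreover have "S g \<in> R" using g WR by (auto simp: W_def)
    ultimately have "S g * (g * S m) \<in> R" by (rule RR(3)[rotated])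
    then have Sm: "S m \<in> R" by (simp add: grouplike_S(1)[OF g(1)] flip: mult.assoc)
    have "S (lsl h m) \<in> R" if h: "linf h" for h
    proof -
      have "S (lsl h m) = S (lsl h m - sc (h g) m) + sc (h g) (S m)" by (simp flip: S_add S_scale)
      then show ?thesis
        using SN[OF m(3)[OF h]] Sm by (simp add: subspace_add[OF RR(1)] subspace_scale[OF RR(1)])
    qed
    then show False using m(1,2) by (simp add: N_def)
  qed
  have "A \<union> B \<subseteq> {x \<in> R. S x \<in> R}"
  proof -
    have "S x \<in> R" if "x \<in> A" for x using that CN SN C(2) span_base by blast
    \<comment> \<open>S sends the adjoined inverses back to group-like elements of C, so no new
      generators arise.\<close>
    moreover have "S x \<in> R" if "x \<in> B" for x
    proof -
      obtain g where "g \<in> C" "grouplike g" "x = S g" using \<open>x \<in> B\<close> B(1) unfolding W_def by blast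
      then show ?thesis using grouplike_S(3) CR by auto
    qed
    ultimately show ?thesis using AB by blast
  qed
  then have SR: "S x \<in> R" if "x \<in> R" for x
    using alg_gen_minimal[OF subalgebra_S_closed[OF R]] that unfolding R_def by blast
  have "(S ^^ i) c \<in> R" if "c \<in> C" for i c
    by (induction i) (use that CR SR in auto)
  then have "(\<Union>i. (S ^^ i) ` C) \<subseteq> alg_gen sc (A \<union> B)" by (auto simp: R_def)
  moreover have "finite (A \<union> B)" using C(3) \<open>finite B\<close> by simp
  ultimately show ?thesis by (rule that[rotated])
qed

section \<open>Countable dimension\<close>

lemma countable_dim_alg_gen:
  assumes X: "countable X" and gen: "alg_gen sc X = UNIV"
  shows "countable_dim sc"
proof -
  define M where "M = prod_list ` lists X"
  have "subalgebra sc (span M)"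
    unfolding subalgebra_def
  proof (intro conjI ballI)
    show "subspace (span M)" by simp
    show "1 \<in> span M" unfolding M_def by (intro span_base image_eqI[of _ _ "[]"]) auto
    have MM: "x * y \<in> M" if "x \<in> M" "y \<in> M" for x y
    proof -
      obtain xs ys where "x = prod_list xs" "y = prod_list ys" "xs \<in> lists X" "ys \<in> lists X"
        using \<open>x \<in> M\<close> \<open>y \<in> M\<close> unfolding M_def by blast
      then have "x * y = prod_list (xs @ ys)" "xs @ ys \<in> lists X" by auto
      then show ?thesis unfolding M_def by blast
    qed
    have 1: "x * y \<in> span M" if "x \<in> M" "y \<in> span M" for x y using that(2)
    proof (induction rule: span_induct_alt)
      case (step c z y)
      then have "x * z \<in> span M" using MM[OF that(1)] by (intro span_base)
      then show ?case using step(2) by (simp add: distrib_left span_add span_scale)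
    qed (simp add: span_zero)
    show "x * y \<in> span M" if "x \<in> span M" "y \<in> span M" for x y using that(1)
    proof (induction rule: span_induct_alt)
      case (step c z x)
      then show ?case using 1[OF step(1) that(2)] by (simp add: distrib_right span_add span_scale)
    qed (simp add: span_zero)
  qed
  moreover have "X \<subseteq> span M"
  proof
    fix x assume "x \<in> X"
    then have "prod_list [x] \<in> M" unfolding M_def by (intro imageI) auto
    then show "x \<in> span M" by (simp add: span_base)
  qed
  ultimately have sM: "span M = UNIV" using alg_gen_minimal gen by blast
  obtain B where B: "B \<subseteq> M" "independent B" "M \<subseteq> span B"
    using maximal_independent_subset by metis
  have "span M \<subseteq> span B" using B(3) by (intro span_minimal) auto
  then have "span B = UNIV" using sM by auto
  moreover have "countable M" unfolding M_def using X by (intro countable_image countable_lists)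
  then have "countable B" using B(1) countable_subset by blast
  ultimately show ?thesis using B(2) unfolding countable_dim_def by blast
qed

text \<open>The space V may be uncountable as a set. By linearity of the powers of S, the images of
  a finite spanning set already generate, and there are countably many of them.\<close>

lemma S_finite_type_countable_dim:
  assumes "S_finite_type sc S"
  shows "countable_dim sc"
proof -
  obtain A where A: "finite A" "alg_gen sc (\<Union>i. (S ^^ i) ` span A) = UNIV"
    using assms by (auto simp: S_finite_type_def)
  define X where "X = (\<Union>i. (S ^^ i) ` A)"
  have "countable X" unfolding X_def using A(1) by (intro countable_UN countable_image) (auto intro: countable_finite)
  moreover have "alg_gen sc X = UNIV"
  proof -
    have "(S ^^ i) x \<in> alg_gen sc X" if "x \<in> span A" for i x
    proof -
      have lin: "(S ^^ i) (x + y) = (S ^^ i) x + (S ^^ i) y \<and> (S ^^ i) (sc c x) = sc c ((S ^^ i) x)" for x y c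
        by (induction i) (auto simp: S_add S_scale)
      have 0: "(S ^^ i) 0 = 0" using lin[of 0 _ 0] by simp
      note sub = subalgebraD(1)[OF subalgebra_alg_gen[of X]]
      show ?thesis using that
      proof (induction rule: span_induct_alt)
        case base
        show ?case using subspace_0[OF sub] 0 by simp
      next
        case (step c x y)
        have "(S ^^ i) x \<in> alg_gen sc X" using step(1) alg_gen_superset[of X] by (auto simp: X_def)
        then show ?case
          using step(2) lin[of "sc c x" y] lin[of x] by (simp add: subspace_add[OF sub] subspace_scale[OF sub])
      qed
    qed
    then have "(\<Union>i. (S ^^ i) ` span A) \<subseteq> alg_gen sc X" by blast
    from alg_gen_minimal[OF subalgebra_alg_gen this] show ?thesis using A(2) by auto
  qed
  ultimately show ?thesis by (rule countable_dim_alg_gen)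
qed

end

section \<open>The three finiteness statements\<close>

theorem theorem0p5:
  fixes sc :: "'k::field_char_0 \<Rightarrow> 'h::ring_1 \<Rightarrow> 'h"
    and \<Delta> :: "'h \<Rightarrow> ('h \<times> 'h) list"
    and \<epsilon> :: "'h \<Rightarrow> 'k"
    and S :: "'h \<Rightarrow> 'h"
  assumes "alg_closed TYPE('k)"
    and "hopf_algebra sc \<Delta> \<epsilon> S"
    and "left_noetherian TYPE('h)"
  shows "(FF sc \<Delta> S \<longrightarrow> S_finite_type sc S \<and> countable_dim sc)
       \<and> (FF sc \<Delta> S \<and> locally_affine sc \<Delta> S \<longrightarrow> affine sc)
       \<and> (pointed sc \<Delta> \<longrightarrow> affine sc)"
proof -
  interpret hopf sc \<Delta> \<epsilon> S by unfold_locales (rule assms(2))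
  obtain F where F: "finite F" "\<And>x. x \<in> F \<Longrightarrow> \<epsilon> x = 0"
    "\<And>I. left_ideal I \<Longrightarrow> F \<subseteq> I \<Longrightarrow> {x. \<epsilon> x = 0} \<subseteq> I"
    by (rule augmentation_finitely_generated[OF assms(3)]) (rule that)
  obtain C A where C: "subcoalgebra sc \<Delta> C" "F \<subseteq> C" "finite A" "C = span A"
    by (rule finite_subcoalgebra[OF F(1)]) (rule that)
  define K where "K = alg_gen sc (\<Union>i. (S ^^ i) ` C)"
  have K: "hopf_subalgebra sc \<Delta> S K" unfolding K_def by (rule hopf_subalgebra_generated[OF C(1)])
  have "(S ^^ 0) ` C \<subseteq> (\<Union>i. (S ^^ i) ` C)" by (rule UN_upper) simp
  also have "\<dots> \<subseteq> K" unfolding K_def by (rule alg_gen_superset)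
  finally have FK: "F \<subseteq> K" using C(2) by simp
  have FF: "K = UNIV" if "FF sc \<Delta> S" "hopf_subalgebra sc \<Delta> S K" "F \<subseteq> K" for K
    using that by (intro faithfully_flat_eq_UNIV[where F = F] F) (auto simp: FF_def)
  have "S_finite_type sc S" if "FF sc \<Delta> S"
    unfolding S_finite_type_def using FF[OF that K FK] C(3,4) K_def
    by (intro exI[of _ C]) (auto simp: subspace_span)
  moreover have "affine sc" if ff: "FF sc \<Delta> S" and la: "locally_affine sc \<Delta> S"
  proof -
    \<comment> \<open>Local affineness is needed only for F: a Hopf subalgebra containing F is
      already all of H.\<close>
    obtain K G where K: "hopf_subalgebra sc \<Delta> S K" "F \<subseteq> K" "finite G" "alg_gen sc G = K"
      using la F(1) unfolding locally_affine_def by blast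
    then show ?thesis using FF[OF ff K(1,2)] unfolding affine_def by blast
  qed
  moreover have "affine sc" if pt: "pointed sc \<Delta>"
  proof -
    have "K = UNIV" using pt K FK F(2,3) by (rule pointed_eq_UNIV)
    moreover obtain G where G: "finite G" "(\<Union>i. (S ^^ i) ` C) \<subseteq> alg_gen sc G"
      by (rule pointed_finitely_generated[OF pt C(1,4,3)]) (rule that)
    have "K \<subseteq> alg_gen sc G" unfolding K_def by (rule alg_gen_minimal[OF subalgebra_alg_gen G(2)])
    ultimately show ?thesis using G(1) unfolding affine_def by blast
  qed
  ultimately show ?thesis using S_finite_type_countable_dim by blast
qed

end
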